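(* Let $x\in\mathcal{M}$ and suppose $\beta\ge\beta_x$. Suppose $f$ satisfies the Riemannian Łojasiewicz gradient inequality at $x$ (on $\mathcal{M}$) with Riemannian Łojasiewicz exponent $\theta\in(0,\frac12]$. Then $h$ satisfies the (Euclidean) Łojasiewicz gradient inequality at $x$ with Łojasiewicz exponent $\theta$.
   Context: Setting. $\|\cdot\|$ is the $\ell_2$-norm of vectors or the induced operator norm. Let $f:\mathbb{R}^n\to\mathbb{R}$, $c:\mathbb{R}^n\to\mathbb{R}^p$ be differentiable and $\mathcal{M}=\{x\in\mathbb{R}^n: c(x)=0\}$. $J_c(x)\in\mathbb{R}^{n\times p}$ is the transposed Jacobian of $c$ (entry $(i,j)$ is $\partial c_j/\partial x_i$). Assumed: $\nabla f$ and $J_c$ are locally Lipschitz continuous on $\mathbb{R}^n$, and $J_c(x)$ has full column rank for every $x\in\mathcal{M}$. Let $\mathcal{A}:\mathbb{R}^n\to\mathbb{R}^n$ be differentiable with transposed Jacobian $J_{\mathcal{A}}(x)\in\mathbb{R}^{n\times n}$ (entry $(i,j)$ is $\partial\mathcal{A}_j/\partial x_i$), such that $J_{\mathcal{A}}$ is locally Lipschitz continuous on $\mathbb{R}^n$, $\mathcal{A}(x)=x$ for $x\in\mathcal{M}$, and $J_{\mathcal{A}}(x)J_c(x)=0$ for $x\in\mathcal{M}$. Put $g(x)=f(\mathcal{A}(x))$ and, for a penalty parameter $\beta>0$, $h(x)=f(\mathcal{A}(x))+\frac{\beta}{2}\|c(x)\|^2$. $\nabla f(\mathcal{A}(y))$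 denotes $\nabla f$ evaluated at $\mathcal{A}(y)$. Constants. For $x\in\mathcal{M}$, $\rho_x$ is the largest $\rho\in(0,1]$ with $\inf\{\sigma_{\min}(J_c(y)):\|y-x\|\le\rho\}\ge\frac12\sigma_{\min}(J_c(x))$ ($\sigma_{\min}$ = smallest singular value); $\Theta_x=\{y:\|y-x\|\le\rho_x\}$; $\sigma_{x,c}=\sigma_{\min}(J_c(x))$; $M_{x,f}=\sup_{y\in\Theta_x}\|\nabla f(\mathcal{A}(y))\|$; $M_{x,A}=\sup_{y\in\Theta_x}\|J_{\mathcal{A}}(y)\|$; $L_{x,g},L_{x,A},L_{x,b}$ are the least Lipschitz constants on $\Theta_x$ (suprema of difference quotients over $y\ne z$ in $\Theta_x$) of $\nabla g$, $J_{\mathcal{A}}$, and $y\mapsto J_{\mathcal{A}}(y)J_c(\mathcal{A}(y))$ respectively. Put $$\beta_x=\max\Big\{\frac{128L_{x,g}(M_{x,A}+1)^2}{\sigma_{x,c}^2},\ \frac{64M_{x,f}(M_{x,A}+1)L_{x,b}}{\sigma_{x,c}^3},\ \frac{16M_{x,f}L_{x,A}(2M_{x,A}+1)}{\sigma_{x,c}^2}\Big\}.$$ Riemannian gradient. For $x\in\mathcal{M}$ (with the Euclidean metric), $\mathrm{grad}\,f(x)=\nabla f(x)-J_c(x)\lambda(x)$ with $\lambda(x)=(J_c(x)^\top J_c(x))^{-1}J_c(x)^\top\nabla f(x)$. Łojasiewicz inequalities. A function $\phi$ satisfies the (Euclidean) Łojasiewicz gradient inequality at $x$ with exponent $\theta\in(0,1]$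 if there are a neighborhood $U\subset\mathbb{R}^n$ of $x$ and $C>0$ with $\|\nabla\phi(y)\|\ge C|\phi(y)-\phi(x)|^{1-\theta}$ for all $y\in U$. The function $f$ satisfies the Riemannian Łojasiewicz gradient inequality at $x\in\mathcal{M}$ with exponent $\theta\in(0,1]$ if there are a neighborhood $U\subset\mathcal{M}$ of $x$ (relative to $\mathcal{M}$) and $C>0$ with $\|\mathrm{grad}\,f(y)\|\ge C|f(y)-f(x)|^{1-\theta}$ for all $y\in U$. *)

theory Defs
  imports "HOL-Analysis.Analysis"
begin

definition grad :: "('a::real_inner \<Rightarrow> real) \<Rightarrow> 'a \<Rightarrow> 'a" where
  "grad f x = (THE d. GDERIV f x :> d)"

(* Entry (i,j) is the partial derivative of F_j with respect to x_i. *)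
definition tjacobian :: "(real^'n \<Rightarrow> real^'m) \<Rightarrow> real^'n \<Rightarrow> real^'m^'n" where
  "tjacobian F x = transpose (jacobian F (at x))"

(* The instance of norm on real^'m^'n is the Frobenius norm; matrices are measured in the
   induced 2-norm instead. *)
definition opnorm :: "real^'m^'n \<Rightarrow> real" where
  "opnorm A = onorm (\<lambda>v. A *v v)"

(* s is a singular value of A iff it has a pair of unit left and right singular vectors.  For an
   n x m matrix this picks out the min(n,m) usual singular values (without multiplicity): 0 is
   one of them exactly when A is not of full rank. *)
definition singular_value :: "real^'m^'n \<Rightarrow> real \<Rightarrow> bool" where
  "singular_value A s \<longleftrightarrow>
     s \<ge> 0 \<and> (\<exists>u v. norm u = 1 \<and> norm v = 1 \<and>
       A *v v = s *\<^sub>R u \<and> transpose A *v u = s *\<^sub>R v)"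

definition sigma_min :: "real^'m^'n \<Rightarrow> real" where
  "sigma_min A = (LEAST s. singular_value A s)"

(* The norm N on the codomain is a parameter, so that opnorm can be used for matrix-valued maps. *)
definition locally_lipschitz :: "('b::ab_group_add \<Rightarrow> real) \<Rightarrow> ('a::real_normed_vector \<Rightarrow> 'b) \<Rightarrow> bool" where
  "locally_lipschitz N F \<longleftrightarrow>
     (\<forall>x. \<exists>r>0. \<exists>L. \<forall>y\<in>ball x r. \<forall>z\<in>ball x r. N (F y - F z) \<le> L * norm (y - z))"

definition lip_const ::
  "('b::ab_group_add \<Rightarrow> real) \<Rightarrow> 'a::real_normed_vector set \<Rightarrow> ('a \<Rightarrow> 'b) \<Rightarrow> real" where
  "lip_const N S F = Sup {N (F y - F z) / norm (y - z) | y z. y \<in> S \<and> z \<in> S \<and> y \<noteq> z}"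

definition feasible_set :: "('a \<Rightarrow> 'b::zero) \<Rightarrow> 'a set" where
  "feasible_set c = {x. c x = 0}"

definition penalty_fun ::
  "(real^'n \<Rightarrow> real) \<Rightarrow> (real^'n \<Rightarrow> real^'p) \<Rightarrow> (real^'n \<Rightarrow> real^'n) \<Rightarrow> real \<Rightarrow> real^'n \<Rightarrow> real" where
  "penalty_fun f c A \<beta> = (\<lambda>y. f (A y) + \<beta> / 2 * (norm (c y))\<^sup>2)"

definition rho :: "(real^'n \<Rightarrow> real^'p) \<Rightarrow> real^'n \<Rightarrow> real" where
  "rho c x = (GREATEST r. 0 < r \<and> r \<le> 1 \<and>
     (INF y\<in>cball x r. sigma_min (tjacobian c y)) \<ge> 1 / 2 * sigma_min (tjacobian c x))"

definition Theta :: "(real^'n \<Rightarrow> real^'p) \<Rightarrow> real^'n \<Rightarrow> (real^'n) set" where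
  "Theta c x = cball x (rho c x)"

definition beta_bound ::
  "(real^'n \<Rightarrow> real) \<Rightarrow> (real^'n \<Rightarrow> real^'p) \<Rightarrow> (real^'n \<Rightarrow> real^'n) \<Rightarrow> real^'n \<Rightarrow> real" where
  "beta_bound f c A x =
    (let \<sigma> = sigma_min (tjacobian c x);
         M\<^sub>f = (SUP y\<in>Theta c x. norm (grad f (A y)));
         M\<^sub>A = (SUP y\<in>Theta c x. opnorm (tjacobian A y));
         L\<^sub>g = lip_const norm (Theta c x) (grad (\<lambda>y. f (A y)));
         L\<^sub>A = lip_const opnorm (Theta c x) (tjacobian A);
         L\<^sub>b = lip_const opnorm (Theta c x) (\<lambda>y. tjacobian A y ** tjacobian c (A y))
     in Max {128 * L\<^sub>g * (M\<^sub>A + 1)\<^sup>2 / \<sigma>\<^sup>2,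
             64 * M\<^sub>f * (M\<^sub>A + 1) * L\<^sub>b / \<sigma> ^ 3,
             16 * M\<^sub>f * L\<^sub>A * (2 * M\<^sub>A + 1) / \<sigma>\<^sup>2})"

definition multiplier :: "(real^'n \<Rightarrow> real) \<Rightarrow> (real^'n \<Rightarrow> real^'p) \<Rightarrow> real^'n \<Rightarrow> real^'p" where
  "multiplier f c x =
     matrix_inv (transpose (tjacobian c x) ** tjacobian c x) *v
       (transpose (tjacobian c x) *v grad f x)"

definition riem_grad :: "(real^'n \<Rightarrow> real) \<Rightarrow> (real^'n \<Rightarrow> real^'p) \<Rightarrow> real^'n \<Rightarrow> real^'n" where
  "riem_grad f c x = grad f x - tjacobian c x *v multiplier f c x"

(* 0 powr 0 = 0, so for \<theta> = 1 the two inequalities below demand nothing at points where the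
   function takes the value it has at x. *)
definition lojasiewicz :: "(real^'n \<Rightarrow> real) \<Rightarrow> real^'n \<Rightarrow> real \<Rightarrow> bool" where
  "lojasiewicz \<phi> x \<theta> \<longleftrightarrow>
     0 < \<theta> \<and> \<theta> \<le> 1 \<and>
     (\<exists>U C. open U \<and> x \<in> U \<and> C > 0 \<and>
       (\<forall>y\<in>U. norm (grad \<phi> y) \<ge> C * \<bar>\<phi> y - \<phi> x\<bar> powr (1 - \<theta>)))"

definition riem_lojasiewicz ::
  "(real^'n \<Rightarrow> real) \<Rightarrow> (real^'n \<Rightarrow> real^'p) \<Rightarrow> real^'n \<Rightarrow> real \<Rightarrow> bool" where
  "riem_lojasiewicz f c x \<theta> \<longleftrightarrow>
     0 < \<theta> \<and> \<theta> \<le> 1 \<and>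
     (\<exists>U C. openin (top_of_set (feasible_set c)) U \<and> x \<in> U \<and> C > 0 \<and>
       (\<forall>y\<in>U. norm (riem_grad f c y) \<ge> C * \<bar>f y - f x\<bar> powr (1 - \<theta>)))"

end

theory Submission
  imports Defs
begin

text \<open>
Write \<open>J\<close> for the transposed Jacobian of \<open>A\<close>, \<open>G\<close> for that of \<open>c\<close>, \<open>M\<close> for the feasible set,
\<open>\<sigma>\<close> for the least singular value of \<open>G x\<close>, and \<open>g = f \<circ> A\<close>, so that
\<open>grad h y = J y *v grad f (A y) + \<beta> *\<^sub>R (G y *v c y)\<close> for the penalty function \<open>h\<close>.
Everything rests on a comparison of \<open>y\<close> near \<open>x\<close> with a feasible point \<open>z\<close> that satisfies
\<open>norm (z - y) \<le> 2 / \<sigma> * norm (c y)\<close> (\<open>exists_feasible_near\<close>). Such a point is found by Banach's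
fixed point theorem, applied to a simplified Newton iteration that moves \<open>y\<close> within the range of \<open>G x\<close>.

At feasible points \<open>A\<close> fixes \<open>M\<close>, so its derivative is the identity on the tangent space
(\<open>derivative_fixes_tangent\<close>). Together with \<open>J ** G = 0\<close> this makes \<open>J\<close> a projection that
annihilates the range of \<open>G\<close> (\<open>tjacobian_idempotent\<close>). Moreover, the tangential part of
\<open>grad g z\<close> is the Riemannian gradient, whence \<open>norm (riem_grad f c z) \<le> norm (grad g z)\<close> (\<open>norm_riem_grad_le\<close>).

The size of \<open>\<beta>\<close> enters in the estimate \<open>norm (c y) \<le> K * norm (grad h y)\<close>
(\<open>norm_constraint_le_grad_penalty\<close>). The complementary projection \<open>mat 1 - J y\<close> keeps \<open>G y *v c y\<close> up
to a small error, while it kills \<open>J y *v grad f (A y)\<close> up to a multiple of \<open>norm (y - z)\<close>, that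
is, up to a multiple of \<open>norm (c y)\<close>; the bound on \<open>\<beta>\<close> makes this multiple smaller than the
contribution of the penalty term.

Now let \<open>N = norm (grad h y)\<close>. Both \<open>norm (c y)\<close> and \<open>norm (z - y)\<close> are \<open>O(N)\<close>, so \<open>grad g z\<close>, and
with it \<open>riem_grad f c z\<close>, is \<open>O(N)\<close> as well. In the decomposition
\<open>h y - h x = (g y - g z) + \<beta> / 2 * (norm (c y))\<^sup>2 + (f z - f x)\<close> the first two terms are \<open>O(N\<^sup>2)\<close>,
and the Riemannian inequality says that the last one, raised to the power \<open>1 - \<theta>\<close>, is \<open>O(N)\<close>. Since
\<open>\<theta> \<le> 1 / 2\<close>, the quadratic terms raised to the power \<open>1 - \<theta>\<close> are \<open>O(N)\<close> too
(\<open>powr_le_linear_of_split\<close>).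
\<close>

section \<open>The operator norm of matrices\<close>

lemma inner_transpose_mult:
  fixes M :: "real^'m^'n"
  shows "(transpose M *v u) \<bullet> v = u \<bullet> (M *v v)"
  by (simp add: dot_lmul_matrix)

lemma le_of_square_le_mult:
  fixes a b :: real
  assumes "a * a \<le> b * a" "0 \<le> a" "0 \<le> b"
  shows "a \<le> b"
  using assms by (cases "a = 0") (auto simp: mult_le_cancel_right)

lemma norm_mult_le_opnorm:
  fixes M :: "real^'m^'n"
  shows "norm (M *v v) \<le> opnorm M * norm v"
  unfolding opnorm_def by (rule onorm) simp

lemma opnorm_leI:
  fixes M :: "real^'m^'n"
  assumes "\<And>v. norm (M *v v) \<le> b * norm v"
  shows "opnorm M \<le> b"
  unfolding opnorm_def using assms by (rule onorm_le)

lemma opnorm_nonneg: "0 \<le> opnorm (M :: real^'m^'n)"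
  unfolding opnorm_def by (rule onorm_pos_le) simp

lemma opnorm_zero [simp]: "opnorm (0 :: real^'m^'n) = 0"
  by (intro antisym opnorm_nonneg opnorm_leI) simp

lemma opnorm_minus_commute: "opnorm (M - N) = opnorm (N - M :: real^'m^'n)"
  by (intro antisym opnorm_leI)
     (metis matrix_vector_mult_diff_rdistrib norm_minus_commute norm_mult_le_opnorm)+

lemma opnorm_triangle: "opnorm (M + N) \<le> opnorm M + opnorm (N :: real^'m^'n)"
proof (rule opnorm_leI)
  fix v :: "real^'m"
  have "norm ((M + N) *v v) \<le> norm (M *v v) + norm (N *v v)"
    by (simp add: matrix_vector_mult_add_rdistrib norm_triangle_ineq)
  also have "\<dots> \<le> (opnorm M + opnorm N) * norm v"
    using norm_mult_le_opnorm[of M v] norm_mult_le_opnorm[of N v] by (simp add: distrib_right)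
  finally show "norm ((M + N) *v v) \<le> (opnorm M + opnorm N) * norm v" .
qed

lemma norm_opnorm_diff_le: "norm (opnorm M - opnorm N) \<le> opnorm (M - N :: real^'m^'n)"
  using opnorm_triangle[of "M - N" N] opnorm_triangle[of "N - M" M]
  by (simp add: opnorm_minus_commute[of N M])

lemma opnorm_transpose_le: "opnorm (transpose M) \<le> opnorm (M :: real^'m^'n)"
proof (rule opnorm_leI)
  fix u :: "real^'n"
  let ?w = "transpose M *v u"
  have "(norm ?w)\<^sup>2 = u \<bullet> (M *v ?w)"
    by (simp add: power2_norm_eq_inner dot_lmul_matrix)
  also have "\<dots> \<le> norm u * norm (M *v ?w)" by (rule norm_cauchy_schwarz)
  also have "\<dots> \<le> norm u * (opnorm M * norm ?w)"
    by (intro mult_left_mono norm_mult_le_opnorm) simp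
  finally have "norm ?w * norm ?w \<le> (opnorm M * norm u) * norm ?w"
    by (simp add: power2_eq_square mult_ac)
  then show "norm ?w \<le> opnorm M * norm u"
    by (rule le_of_square_le_mult) (simp_all add: opnorm_nonneg)
qed

lemma opnorm_transpose: "opnorm (transpose M) = opnorm (M :: real^'m^'n)"
  using opnorm_transpose_le[of M] opnorm_transpose_le[of "transpose M"] by simp

lemma opnorm_mat_1_minus_le: "opnorm (mat 1 - M) \<le> 1 + opnorm (M :: real^'n^'n)"
proof (rule opnorm_leI)
  fix v :: "real^'n"
  have "norm ((mat 1 - M) *v v) \<le> norm v + norm (M *v v)"
    by (simp add: matrix_vector_mult_diff_rdistrib norm_triangle_ineq4)
  also have "\<dots> \<le> (1 + opnorm M) * norm v"
    using norm_mult_le_opnorm[of M v] by (simp add: distrib_right)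
  finally show "norm ((mat 1 - M) *v v) \<le> (1 + opnorm M) * norm v" .
qed

section \<open>The least singular value\<close>

lemma exists_min_norm_mult:
  fixes M :: "real^'p^'n"
  obtains v where "norm v = 1" "\<And>w. norm w = 1 \<Longrightarrow> norm (M *v v) \<le> norm (M *v w)"
proof -
  have "continuous_on (sphere 0 1) (\<lambda>v. norm (M *v v))"
    by (intro continuous_on_norm linear_continuous_on) simp
  moreover have "sphere (0::real^'p) 1 \<noteq> {}" by simp
  ultimately show ?thesis
    using continuous_attains_inf[of "sphere (0::real^'p) 1" "\<lambda>v. norm (M *v v)"] that
    by (auto simp: dist_norm)
qed

text \<open>
The Rayleigh quotient of the Gram matrix is stationary at its minimum: moving from \<open>v\<close> in the
direction of the residual \<open>r\<close> of the eigenvector equation changes the quadratic form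
\<open>(norm (M *v w))\<^sup>2 - s\<^sup>2 * (norm w)\<^sup>2\<close>, which is nonnegative and vanishes at \<open>v\<close>, to first order by
\<open>2 * (r \<bullet> r)\<close>.
\<close>

lemma gram_eigenvector_of_min:
  fixes M :: "real^'p^'n"
  assumes v: "norm v = 1" and min: "\<And>w. norm w = 1 \<Longrightarrow> norm (M *v v) \<le> norm (M *v w)"
  shows "transpose M *v (M *v v) = (norm (M *v v))\<^sup>2 *\<^sub>R v"
proof -
  let ?s = "norm (M *v v)"
  have hom: "?s\<^sup>2 * (norm w)\<^sup>2 \<le> (norm (M *v w))\<^sup>2" for w
  proof (cases "w = 0")
    case False
    then have "?s \<le> norm (M *v ((1 / norm w) *\<^sub>R w))" by (intro min) simp
    also have "\<dots> = norm (M *v w) / norm w" using False by (simp add: matrix_vector_mult_scaleR)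
    finally have "?s * norm w \<le> norm (M *v w)" using False by (simp add: field_simps)
    then have "(?s * norm w)\<^sup>2 \<le> (norm (M *v w))\<^sup>2" by (intro power_mono) auto
    then show ?thesis by (simp add: power_mult_distrib)
  qed simp
  define r where "r = transpose M *v (M *v v) - ?s\<^sup>2 *\<^sub>R v"
  have quad: "0 \<le> 2 * t * (r \<bullet> r) + t\<^sup>2 * ((norm (M *v r))\<^sup>2 - ?s\<^sup>2 * (norm r)\<^sup>2)" for t
  proof -
    have "(norm (M *v (v + t *\<^sub>R r)))\<^sup>2
        = ?s\<^sup>2 + 2 * t * ((M *v v) \<bullet> (M *v r)) + t\<^sup>2 * (norm (M *v r))\<^sup>2"
      unfolding power2_norm_eq_inner matrix_vector_right_distrib matrix_vector_mult_scaleR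
      by (simp add: algebra_simps inner_commute power2_eq_square)
    moreover have "(norm (v + t *\<^sub>R r))\<^sup>2 = 1 + 2 * t * (v \<bullet> r) + t\<^sup>2 * (norm r)\<^sup>2"
      using v unfolding power2_norm_eq_inner norm_eq_1
      by (simp add: algebra_simps inner_commute power2_eq_square)
    moreover have "(M *v v) \<bullet> (M *v r) = r \<bullet> r + ?s\<^sup>2 * (v \<bullet> r)"
    proof -
      have "r \<bullet> r = (transpose M *v (M *v v) - ?s\<^sup>2 *\<^sub>R v) \<bullet> r" by (simp only: r_def)
      then show ?thesis by (simp add: inner_diff_left dot_lmul_matrix)
    qed
    ultimately show ?thesis using hom[of "v + t *\<^sub>R r"] by (simp add: distrib_left right_diff_distrib mult_ac)
  qed
  have "r = 0"
  proof (rule ccontr)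
    assume "r \<noteq> 0"
    define b where "b = r \<bullet> r"
    define d where "d = (norm (M *v r))\<^sup>2 - ?s\<^sup>2 * (norm r)\<^sup>2"
    have b: "b > 0" using \<open>r \<noteq> 0\<close> by (simp add: b_def)
    have d: "d \<ge> 0" using hom[of r] by (simp add: d_def)
    \<comment> \<open>A negative step so short that the quadratic term cannot outweigh the linear one.\<close>
    define t where "t = - b / (d + 1)"
    have "t < 0" using b d by (simp add: t_def)
    have "0 \<le> t * (2 * b + t * d)"
      using quad[of t] by (simp add: b_def d_def power2_eq_square algebra_simps)
    then have "2 * b + t * d \<le> 0" using \<open>t < 0\<close> by (simp add: zero_le_mult_iff)
    moreover have "t * d \<ge> - b" using b d by (simp add: t_def field_simps)
    ultimately show False using b by simp
  qed
  then show ?thesis by (simp add: r_def)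
qed

text \<open>
If the minimum \<open>s\<close> of \<open>norm (M *v w)\<close> over unit vectors is positive, then the minimizer and its
normalized image are a pair of singular vectors. If it is zero, a left singular vector has to be
produced separately; the kernel of \<open>transpose M\<close> contains one because the rank of \<open>M\<close> is then
smaller than \<open>CARD('p) \<le> CARD('n)\<close>.
\<close>

lemma sigma_min_eq_min_norm:
  fixes M :: "real^'p^'n"
  assumes le: "CARD('p) \<le> CARD('n)"
    and v: "norm v = 1" and min: "\<And>w. norm w = 1 \<Longrightarrow> norm (M *v v) \<le> norm (M *v w)"
  shows "sigma_min M = norm (M *v v)"
  unfolding sigma_min_def
proof (rule Least_equality)
  let ?s = "norm (M *v v)"
  have eig: "transpose M *v (M *v v) = ?s\<^sup>2 *\<^sub>R v"
    using v min by (rule gram_eigenvector_of_min)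
  show "singular_value M ?s"
  proof (cases "?s = 0")
    case False
    let ?u = "(1 / ?s) *\<^sub>R (M *v v)"
    have "transpose M *v ?u = ?s *\<^sub>R v"
      unfolding matrix_vector_mult_scaleR eig using False by (simp add: power2_eq_square)
    moreover have "M *v v = ?s *\<^sub>R ?u" "norm ?u = 1" using False by auto
    ultimately show ?thesis using v unfolding singular_value_def by (metis norm_ge_zero)
  next
    case True
    have "\<not> inj ((*v) M)"
      using True v by (auto simp: inj_on_def) (metis matrix_vector_mult_0_right norm_zero zero_neq_one)
    then have "rank M \<noteq> CARD('p)" using full_rank_injective by blast
    then have "rank (transpose M) < CARD('n)" 
      using rank_bound[of M] le by (simp add: rank_transpose)
    then have "\<not> inj ((*v) (transpose M))" using full_rank_injective by (metis less_irrefl)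
    then obtain a b where "a \<noteq> b" "transpose M *v a = transpose M *v b"
      by (auto simp: inj_on_def)
    then have "transpose M *v (a - b) = 0" "a - b \<noteq> 0"
      by (simp_all add: matrix_vector_mult_diff_distrib)
    then have "transpose M *v ((1 / norm (a - b)) *\<^sub>R (a - b)) = 0"
        "norm ((1 / norm (a - b)) *\<^sub>R (a - b)) = 1"
      unfolding matrix_vector_mult_scaleR by auto
    then show ?thesis
      using True v unfolding singular_value_def by (metis norm_eq_zero order_refl scaleR_zero_left)
  qed
  fix s assume "singular_value M s"
  then obtain u w where "s \<ge> 0" "norm u = 1" "norm w = 1" "M *v w = s *\<^sub>R u"
    unfolding singular_value_def by auto
  then show "?s \<le> s" using min[of w] by simp
qed

lemma sigma_min_nonneg:
  fixes M :: "real^'p^'n"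
  assumes "CARD('p) \<le> CARD('n)"
  shows "0 \<le> sigma_min M"
  by (metis assms exists_min_norm_mult[of M] norm_ge_zero sigma_min_eq_min_norm)

lemma sigma_min_mult_le:
  fixes M :: "real^'p^'n"
  assumes "CARD('p) \<le> CARD('n)"
  shows "sigma_min M * norm w \<le> norm (M *v w)"
proof (cases "w = 0")
  case False
  obtain v where v: "norm v = 1" "\<And>w. norm w = 1 \<Longrightarrow> norm (M *v v) \<le> norm (M *v w)"
    using exists_min_norm_mult[of M] by blast
  have "sigma_min M = norm (M *v v)" using assms v by (rule sigma_min_eq_min_norm)
  also have "\<dots> \<le> norm (M *v ((1 / norm w) *\<^sub>R w))" using False by (intro v) simp
  also have "\<dots> = norm (M *v w) / norm w" using False by (simp add: matrix_vector_mult_scaleR)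
  finally show ?thesis using False by (simp add: field_simps)
qed simp

lemma sigma_min_pos:
  fixes M :: "real^'p^'n"
  assumes "rank M = CARD('p)"
  shows "0 < sigma_min M"
proof -
  have le: "CARD('p) \<le> CARD('n)" using rank_bound[of M] assms by simp
  obtain v where v: "norm v = 1" "\<And>w. norm w = 1 \<Longrightarrow> norm (M *v v) \<le> norm (M *v w)"
    using exists_min_norm_mult[of M] by blast
  have "inj ((*v) M)" using assms full_rank_injective by blast
  then have "M *v v \<noteq> 0"
    using v(1) by (metis inj_on_contraD UNIV_I matrix_vector_mult_0_right norm_zero zero_neq_one)
  then show ?thesis by (simp add: sigma_min_eq_min_norm[OF le v])
qed

lemma sigma_min_diff_le:
  fixes M N :: "real^'p^'n"
  assumes "CARD('p) \<le> CARD('n)"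
  shows "sigma_min M \<le> sigma_min N + opnorm (M - N)"
proof -
  obtain v where v: "norm v = 1" "\<And>w. norm w = 1 \<Longrightarrow> norm (N *v v) \<le> norm (N *v w)"
    using exists_min_norm_mult[of N] by blast
  have "sigma_min M \<le> norm (M *v v)" using sigma_min_mult_le[OF assms, of M v] v by simp
  also have "\<dots> = norm (N *v v + (M - N) *v v)" by (simp add: matrix_vector_mult_diff_rdistrib)
  also have "\<dots> \<le> norm (N *v v) + opnorm (M - N)"
    using norm_triangle_ineq[of "N *v v" "(M - N) *v v"] norm_mult_le_opnorm[of "M - N" v] v(1) by simp
  finally show ?thesis using sigma_min_eq_min_norm[OF assms v] by simp
qed

lemma abs_sigma_min_diff_le:
  fixes M N :: "real^'p^'n"
  assumes "CARD('p) \<le> CARD('n)"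
  shows "\<bar>sigma_min M - sigma_min N\<bar> \<le> opnorm (M - N)"
  using sigma_min_diff_le[OF assms, of M N] sigma_min_diff_le[OF assms, of N M]
  by (simp add: opnorm_minus_commute[of N M])

section \<open>Locally Lipschitz maps\<close>

lemma locally_lipschitzE:
  assumes "locally_lipschitz N F"
  obtains r L where "r > 0" "L \<ge> 0"
    "\<And>y z. y \<in> ball x r \<Longrightarrow> z \<in> ball x r \<Longrightarrow> N (F y - F z) \<le> L * norm (y - z)"
proof -
  obtain r L where r: "r > 0"
    and L: "\<And>y z. y \<in> ball x r \<Longrightarrow> z \<in> ball x r \<Longrightarrow> N (F y - F z) \<le> L * norm (y - z)"
    using assms unfolding locally_lipschitz_def by metis
  have "N (F y - F z) \<le> max L 0 * norm (y - z)" if "y \<in> ball x r" "z \<in> ball x r" for y z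
    using L[OF that] mult_right_mono[of L "max L 0" "norm (y - z)"] by simp
  then show ?thesis using r that[of r "max L 0"] by simp
qed

text \<open>
The codomain of \<open>F\<close> need not carry a topology, so continuity is asserted after a map \<open>\<phi>\<close> into a
normed space that does not increase distances measured by \<open>N\<close>. This map will be a norm, a least singular value, or the identity.
\<close>

lemma continuous_on_of_locally_lipschitz:
  fixes F :: "'a::real_normed_vector \<Rightarrow> 'b::ab_group_add" and \<phi> :: "'b \<Rightarrow> 'c::real_normed_vector"
  assumes lip: "locally_lipschitz N F" and le: "\<And>a b. norm (\<phi> a - \<phi> b) \<le> N (a - b)"
  shows "continuous_on S (\<lambda>y. \<phi> (F y))"
proof (rule continuous_at_imp_continuous_on, rule ballI)
  fix y
  obtain r L where r: "r > 0"
    and L: "\<And>u v. u \<in> ball y r \<Longrightarrow> v \<in> ball y r \<Longrightarrow> N (F u - F v) \<le> L * norm (u - v)"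
    using lip unfolding locally_lipschitz_def by metis
  have "((\<lambda>u. \<phi> (F u) - \<phi> (F y)) \<longlongrightarrow> 0) (at y)"
  proof (rule Lim_null_comparison)
    show "\<forall>\<^sub>F u in at y. norm (\<phi> (F u) - \<phi> (F y)) \<le> L * norm (u - y)"
      unfolding eventually_at
    proof (intro exI[of _ r] conjI ballI impI r)
      fix u assume "u \<noteq> y \<and> dist u y < r"
      then have "N (F u - F y) \<le> L * norm (u - y)"
        using r by (intro L) (auto simp: dist_commute)
      then show "norm (\<phi> (F u) - \<phi> (F y)) \<le> L * norm (u - y)"
        using le[of "F u" "F y"] by simp
    qed
    show "((\<lambda>u. L * norm (u - y)) \<longlongrightarrow> 0) (at y)"
      by (auto intro!: tendsto_eq_intros)
  qed
  then show "isCont (\<lambda>y. \<phi> (F y)) y"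
    unfolding isCont_def using Lim_null by blast
qed

text \<open>
On a compact set the difference quotients of a locally Lipschitz map are bounded, so that
\<open>lip_const\<close>, a supremum of reals, is a genuine Lipschitz constant. Otherwise there would be pairs of
points with quotients tending to infinity; as the map is bounded, the points of these pairs
approach each other, hence accumulate at a single point, near which the quotients are bounded.
\<close>

lemma opnorm_diff_le_lip_const:
  fixes F :: "'a::real_normed_vector \<Rightarrow> real^'m^'n"
  assumes lip: "locally_lipschitz opnorm F" and S: "compact S" and "y \<in> S" "z \<in> S"
  shows "opnorm (F y - F z) \<le> lip_const opnorm S F * norm (y - z)"
proof -
  define Q where "Q = {opnorm (F y - F z) / norm (y - z) | y z. y \<in> S \<and> z \<in> S \<and> y \<noteq> z}"
  have "compact ((\<lambda>y. opnorm (F y)) ` S)"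
    using lip norm_opnorm_diff_le by (intro compact_continuous_image continuous_on_of_locally_lipschitz S)
  then obtain B where B: "\<And>y. y \<in> S \<Longrightarrow> opnorm (F y) \<le> B"
    by (meson bdd_above.E bounded_imp_bdd_above compact_imp_bounded imageI)
  have "bdd_above Q"
  proof (rule ccontr)
    assume "\<not> bdd_above Q"
    then have "\<exists>y z. y \<in> S \<and> z \<in> S \<and> y \<noteq> z \<and> opnorm (F y - F z) / norm (y - z) > real k" for k
      unfolding bdd_above_def Q_def by (simp add: not_le) blast
    then obtain Y Z where YZ: "\<And>k. Y k \<in> S" "\<And>k. Z k \<in> S" "\<And>k. Y k \<noteq> Z k"
      and big: "\<And>k. opnorm (F (Y k) - F (Z k)) / norm (Y k - Z k) > real k"
      by metis
    obtain l \<phi> where "strict_mono \<phi>" and lim: "(Y \<circ> \<phi>) \<longlonglongrightarrow> l"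
      using S YZ(1) unfolding compact_def by blast
    obtain r L where r: "r > 0" and
      L: "\<And>y z. y \<in> ball l r \<Longrightarrow> z \<in> ball l r \<Longrightarrow> opnorm (F y - F z) \<le> L * norm (y - z)"
      using locally_lipschitzE[OF lip, of l] by metis
    \<comment> \<open>\<open>B\<close> bounds the numerators by \<open>2 * B\<close>, so large quotients need small denominators.\<close>
    have close: "norm (Y k - Z k) \<le> 2 * B / real k" if "k > 0" for k
    proof -
      have "real k * norm (Y k - Z k) < opnorm (F (Y k) - F (Z k))"
        using big[of k] YZ(3)[of k] by (simp add: field_simps)
      also have "\<dots> \<le> opnorm (F (Y k)) + opnorm (0 - F (Z k))"
        using opnorm_triangle[of "F (Y k)" "0 - F (Z k)"] by simp
      also have "\<dots> \<le> 2 * B"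
        using B[OF YZ(1)[of k]] B[OF YZ(2)[of k]] opnorm_minus_commute[of 0 "F (Z k)"] by simp
      finally show ?thesis using that by (simp add: field_simps)
    qed
    have "(\<lambda>k. Y k - Z k) \<longlonglongrightarrow> 0"
    proof (rule Lim_null_comparison)
      show "\<forall>\<^sub>F k in sequentially. norm (Y k - Z k) \<le> 2 * B / real k"
        using close by (intro eventually_sequentiallyI[of 1]) auto
      show "(\<lambda>k. 2 * B / real k) \<longlonglongrightarrow> 0" by (rule lim_const_over_n)
    qed
    then have "((\<lambda>k. Y k - Z k) \<circ> \<phi>) \<longlonglongrightarrow> 0"
      using \<open>strict_mono \<phi>\<close> by (rule LIMSEQ_subseq_LIMSEQ)
    from tendsto_diff[OF lim this] have limZ: "(Z \<circ> \<phi>) \<longlonglongrightarrow> l" by (simp add: o_def)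
    have "\<forall>\<^sub>F k in sequentially. (Y \<circ> \<phi>) k \<in> ball l r"
      using lim by (rule topological_tendstoD) (simp_all add: r)
    moreover have "\<forall>\<^sub>F k in sequentially. (Z \<circ> \<phi>) k \<in> ball l r"
      using limZ by (rule topological_tendstoD) (simp_all add: r)
    moreover have "\<forall>\<^sub>F k in sequentially. k \<ge> nat \<lceil>L\<rceil>"
      by (rule eventually_ge_at_top)
    ultimately have "\<forall>\<^sub>F k in sequentially. False"
    proof eventually_elim
      case (elim k)
      have "real (\<phi> k) \<ge> L"
        using elim(3) seq_suble[OF \<open>strict_mono \<phi>\<close>, of k] by linarith
      then have "opnorm (F (Y (\<phi> k)) - F (Z (\<phi> k))) > L * norm (Y (\<phi> k) - Z (\<phi> k))"
        using big[of "\<phi> k"] YZ(3)[of "\<phi> k"] by (simp add: field_simps)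
          (smt (verit) mult_right_mono norm_ge_zero)
      with L[of "Y (\<phi> k)" "Z (\<phi> k)"] elim show False by auto
    qed
    then show False by simp
  qed
  show ?thesis
  proof (cases "y = z")
    case False
    then have "opnorm (F y - F z) / norm (y - z) \<in> Q" unfolding Q_def using assms by blast
    then have "opnorm (F y - F z) / norm (y - z) \<le> lip_const opnorm S F"
      unfolding lip_const_def Q_def[symmetric] using \<open>bdd_above Q\<close> by (rule cSup_upper)
    then show ?thesis using False by (simp add: field_simps)
  qed simp
qed

text \<open>
The radius \<open>rho\<close> is specified by a greatest element, so that its positivity presupposes that a
greatest admissible radius exists. It does: by continuity of the least singular value, small radii are
admissible, and the supremum of the admissible radii is itself admissible.
\<close>

lemma rho_pos:
  fixes c :: "real^'n \<Rightarrow> real^'p"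
  assumes le: "CARD('p) \<le> CARD('n)" and lip: "locally_lipschitz opnorm (tjacobian c)"
    and pos: "0 < sigma_min (tjacobian c x)"
  shows "0 < rho c x"
proof -
  define s where "s y = sigma_min (tjacobian c y)" for y
  define R where "R = {r. 0 < r \<and> r \<le> 1 \<and> (\<forall>y\<in>cball x r. s y \<ge> s x / 2)}"
  have s0: "s y \<ge> 0" for y unfolding s_def by (rule sigma_min_nonneg[OF le])
  have cont: "continuous_on UNIV s"
    unfolding s_def using abs_sigma_min_diff_le[OF le]
    by (intro continuous_on_of_locally_lipschitz[OF lip]) simp
  have inf_iff: "(INF y\<in>cball x r. s y) \<ge> s x / 2 \<longleftrightarrow> (\<forall>y\<in>cball x r. s y \<ge> s x / 2)"
    if "r > 0" for r
    using that by (intro le_cINF_iff bdd_belowI2[of _ 0] s0) auto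
  have clo: "closed {y. s y \<ge> s x / 2}" using cont by (intro closed_Collect_le) auto
  have opn: "open {y. s y > s x / 2}" using cont by (intro open_Collect_less) auto
  have "x \<in> {y. s y > s x / 2}" using pos by (simp add: s_def)
  then obtain e where e: "e > 0" "cball x e \<subseteq> {y. s y > s x / 2}"
    using opn open_contains_cball by blast
  have "min e 1 \<in> R"
    unfolding R_def mem_Collect_eq
  proof (intro conjI ballI)
    fix y assume "y \<in> cball x (min e 1)"
    then have "y \<in> cball x e" by simp
    then show "s y \<ge> s x / 2" using e(2) by force
  qed (use e(1) in auto)
  define m where "m = Sup R"
  have bdd: "bdd_above R" unfolding R_def by (intro bdd_aboveI[of _ 1]) auto
  have m_pos: "0 < m"
    using cSup_upper[OF \<open>min e 1 \<in> R\<close> bdd] e(1) unfolding m_def by linarith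
  have "m \<in> R"
  proof -
    have "m \<le> 1" unfolding m_def using \<open>min e 1 \<in> R\<close>
      by (intro cSup_least) (blast, simp add: R_def)
    \<comment> \<open>Only the open ball is covered by smaller admissible balls; closedness adds the boundary.\<close>
    have "ball x m \<subseteq> {y. s y \<ge> s x / 2}"
    proof
      fix y assume "y \<in> ball x m"
      then obtain r where "r \<in> R" "dist x y < r"
        unfolding m_def using less_cSup_iff[OF _ bdd] \<open>min e 1 \<in> R\<close> by auto
      then show "y \<in> {y. s y \<ge> s x / 2}" by (auto simp: R_def)
    qed
    then have "cball x m \<subseteq> {y. s y \<ge> s x / 2}"
      using closure_minimal[OF _ clo] m_pos by (metis closure_ball)
    then show ?thesis using m_pos \<open>m \<le> 1\<close> by (auto simp: R_def)
  qed
  have "rho c x = m"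
    unfolding rho_def s_def[symmetric]
  proof (rule Greatest_equality)
    show "0 < m \<and> m \<le> 1 \<and> (INF y\<in>cball x m. s y) \<ge> 1 / 2 * s x"
      using \<open>m \<in> R\<close> inf_iff[OF m_pos] by (auto simp: R_def)
    fix r assume "0 < r \<and> r \<le> 1 \<and> (INF y\<in>cball x r. s y) \<ge> 1 / 2 * s x"
    then have "r \<in> R" using inf_iff[of r] by (auto simp: R_def)
    then show "r \<le> m" unfolding m_def by (rule cSup_upper[OF _ bdd])
  qed
  then show ?thesis using m_pos by simp
qed

lemma locally_lipschitz_compose:
  fixes A :: "'a::real_normed_vector \<Rightarrow> 'b::real_normed_vector"
  assumes A: "locally_lipschitz norm A" and F: "locally_lipschitz N F"
  shows "locally_lipschitz N (\<lambda>y. F (A y))"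
  unfolding locally_lipschitz_def
proof
  fix x
  obtain r L where r: "r > 0" "L \<ge> 0" and
    L: "\<And>y z. y \<in> ball x r \<Longrightarrow> z \<in> ball x r \<Longrightarrow> norm (A y - A z) \<le> L * norm (y - z)"
    using locally_lipschitzE[OF A, of x] by metis
  obtain s K where s: "s > 0" "K \<ge> 0" and
    K: "\<And>y z. y \<in> ball (A x) s \<Longrightarrow> z \<in> ball (A x) s \<Longrightarrow> N (F y - F z) \<le> K * norm (y - z)"
    using locally_lipschitzE[OF F, of "A x"] by metis
  define t where "t = min r (s / (L + 1))"
  have t: "t > 0" using r s by (simp add: t_def)
  have near: "A y \<in> ball (A x) s" if "y \<in> ball x t" for y
  proof -
    have d: "norm (x - y) < s / (L + 1)" using that by (simp add: t_def dist_norm)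
    have "norm (A x - A y) \<le> L * norm (x - y)" using that r by (intro L) (auto simp: t_def)
    also have "\<dots> \<le> (L + 1) * norm (x - y)" by (intro mult_right_mono) auto
    also have "\<dots> < s" using d r by (simp add: field_simps)
    finally show ?thesis by (simp add: dist_norm)
  qed
  have "N (F (A y) - F (A z)) \<le> (K * L) * norm (y - z)" if "y \<in> ball x t" "z \<in> ball x t" for y z
  proof -
    have "N (F (A y) - F (A z)) \<le> K * norm (A y - A z)" using near that by (intro K)
    also have "\<dots> \<le> K * (L * norm (y - z))" using that s by (intro mult_left_mono L) (auto simp: t_def)
    finally show ?thesis by simp
  qed
  then show "\<exists>r>0. \<exists>L. \<forall>y\<in>ball x r. \<forall>z\<in>ball x r. N (F (A y) - F (A z)) \<le> L * norm (y - z)"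
    using t by blast
qed

lemma locally_lipschitz_mult_vec:
  fixes J :: "'a::real_normed_vector \<Rightarrow> real^'m^'n" and G :: "'a \<Rightarrow> real^'m"
  assumes J: "locally_lipschitz opnorm J" and G: "locally_lipschitz norm G"
  shows "locally_lipschitz norm (\<lambda>y. J y *v G y)"
  unfolding locally_lipschitz_def
proof
  fix x
  obtain r L where r: "r > 0" "L \<ge> 0" and
    L: "\<And>y z. y \<in> ball x r \<Longrightarrow> z \<in> ball x r \<Longrightarrow> opnorm (J y - J z) \<le> L * norm (y - z)"
    using locally_lipschitzE[OF J, of x] by metis
  obtain s K where s: "s > 0" "K \<ge> 0" and
    K: "\<And>y z. y \<in> ball x s \<Longrightarrow> z \<in> ball x s \<Longrightarrow> norm (G y - G z) \<le> K * norm (y - z)"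
    using locally_lipschitzE[OF G, of x] by metis
  define t where "t = min r s"
  define a where "a = opnorm (J x) + L * t"
  define b where "b = norm (G x) + K * t"
  have t: "t > 0" using r s by (simp add: t_def)
  have a: "opnorm (J y) \<le> a" if "y \<in> ball x t" for y
  proof -
    have "opnorm (J y - J x) \<le> L * norm (y - x)" using L that r by (simp add: t_def)
    also have "\<dots> \<le> L * t" using that r by (intro mult_left_mono) (auto simp: dist_norm norm_minus_commute)
    finally show ?thesis using norm_opnorm_diff_le[of "J y" "J x"] by (simp add: a_def)
  qed
  have b: "norm (G y) \<le> b" if "y \<in> ball x t" for y
  proof -
    have "norm (G y - G x) \<le> K * norm (y - x)" using K that s by (simp add: t_def)
    also have "\<dots> \<le> K * t" using that s by (intro mult_left_mono) (auto simp: dist_norm norm_minus_commute)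
    finally show ?thesis using norm_triangle_sub[of "G y" "G x"] by (simp add: b_def)
  qed
  have "norm (J y *v G y - J z *v G z) \<le> (L * b + a * K) * norm (y - z)"
    if "y \<in> ball x t" "z \<in> ball x t" for y z
  proof -
    have "J y *v G y - J z *v G z = (J y - J z) *v G y + J z *v (G y - G z)"
      by (simp add: matrix_vector_mult_diff_rdistrib matrix_vector_mult_diff_distrib)
    also have "norm \<dots> \<le> opnorm (J y - J z) * norm (G y) + opnorm (J z) * norm (G y - G z)"
      by (intro norm_triangle_le add_mono norm_mult_le_opnorm)
    also have "\<dots> \<le> (L * norm (y - z)) * b + a * (K * norm (y - z))"
      using that r s by (intro add_mono mult_mono L K a b opnorm_nonneg) 
        (auto simp: t_def a_def intro!: add_nonneg_nonneg opnorm_nonneg)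
    finally show ?thesis by (simp add: algebra_simps)
  qed
  then show "\<exists>r>0. \<exists>L. \<forall>y\<in>ball x r. \<forall>z\<in>ball x r. norm (J y *v G y - J z *v G z) \<le> L * norm (y - z)"
    using t by blast
qed

section \<open>Gradients and Jacobians\<close>

text \<open>
Products with a transposed matrix are kept in the form \<open>transpose M *v v\<close>, to which
\<open>inner_transpose_mult\<close> applies.
\<close>

declare transpose_matrix_vector [simp del]
declare inner_transpose_mult [simp]

lemma has_derivative_tjacobian:
  assumes "F differentiable (at y)"
  shows "(F has_derivative (\<lambda>v. transpose (tjacobian F y) *v v)) (at y)"
  using assms unfolding tjacobian_def by (simp add: jacobian_works)

lemma grad_eqI:
  assumes "(f has_derivative (\<lambda>h. h \<bullet> d)) (at y)"
  shows "grad f y = d"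
  unfolding grad_def
proof (rule the_equality)
  show "GDERIV f y :> d" using assms by (simp add: gderiv_def)
  fix e assume "GDERIV f y :> e"
  then have "(\<lambda>h. h \<bullet> e) = (\<lambda>h. h \<bullet> d)"
    using assms unfolding gderiv_def by (intro has_derivative_unique)
  then have "(e - d) \<bullet> e = (e - d) \<bullet> d" by metis
  then have "(e - d) \<bullet> (e - d) = 0" unfolding inner_diff_right[of "e - d" e d] by simp
  then show "e = d" by simp
qed

lemma has_derivative_grad:
  fixes f :: "'a::euclidean_space \<Rightarrow> real"
  assumes "f differentiable (at y)"
  shows "(f has_derivative (\<lambda>h. h \<bullet> grad f y)) (at y)"
proof -
  obtain f' where f': "(f has_derivative f') (at y)"
    using assms unfolding differentiable_def by blast
  have "f' = (\<lambda>h. h \<bullet> adjoint f' 1)"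
    using adjoint_works[OF has_derivative_linear[OF f'], of _ 1] by auto
  then have "(f has_derivative (\<lambda>h. h \<bullet> adjoint f' 1)) (at y)" using f' by simp
  then show ?thesis using grad_eqI by metis
qed

lemma has_derivative_compose_grad:
  fixes A :: "real^'n \<Rightarrow> real^'m"
  assumes "A differentiable (at y)" "f differentiable (at (A y))"
  shows "((\<lambda>y. f (A y)) has_derivative (\<lambda>h. h \<bullet> (tjacobian A y *v grad f (A y)))) (at y)"
  using has_derivative_compose[OF has_derivative_tjacobian[OF assms(1)] has_derivative_grad[OF assms(2)]]
  by simp

lemma has_derivative_penalty_fun:
  assumes "A differentiable (at y)" "f differentiable (at (A y))" "c differentiable (at y)"
  shows "(penalty_fun f c A \<beta> has_derivative
    (\<lambda>h. h \<bullet> (tjacobian A y *v grad f (A y) + \<beta> *\<^sub>R (tjacobian c y *v c y)))) (at y)"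
  unfolding penalty_fun_def power2_norm_eq_inner
  by (rule derivative_eq_intros has_derivative_compose_grad has_derivative_tjacobian assms refl)+
     (simp add: fun_eq_iff inner_add_right inner_commute[of "c y"])

lemma locally_lipschitz_of_tjacobian:
  fixes A :: "real^'n \<Rightarrow> real^'m"
  assumes diff: "\<And>y. A differentiable (at y)" and lip: "locally_lipschitz opnorm (tjacobian A)"
  shows "locally_lipschitz norm A"
  unfolding locally_lipschitz_def
proof
  fix x
  obtain r L where r: "r > 0" "L \<ge> 0" and
    L: "\<And>y z. y \<in> ball x r \<Longrightarrow> z \<in> ball x r \<Longrightarrow> opnorm (tjacobian A y - tjacobian A z) \<le> L * norm (y - z)"
    using locally_lipschitzE[OF lip, of x] by metis
  have B: "opnorm (tjacobian A y) \<le> opnorm (tjacobian A x) + L * r" if "y \<in> ball x r" for y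
  proof -
    have "opnorm (tjacobian A y - tjacobian A x) \<le> L * norm (y - x)" using L that r by simp
    also have "\<dots> \<le> L * r" using that r by (intro mult_left_mono) (auto simp: dist_norm norm_minus_commute)
    finally show ?thesis using norm_opnorm_diff_le[of "tjacobian A y" "tjacobian A x"] by simp
  qed
  have "norm (A y - A z) \<le> (opnorm (tjacobian A x) + L * r) * norm (y - z)"
    if "y \<in> ball x r" "z \<in> ball x r" for y z
  proof (rule differentiable_bound[OF convex_ball _ _ that])
    fix u assume "u \<in> ball x r"
    show "(A has_derivative (\<lambda>v. transpose (tjacobian A u) *v v)) (at u within ball x r)"
      using diff has_derivative_tjacobian has_derivative_at_withinI by blast
    show "onorm (\<lambda>v. transpose (tjacobian A u) *v v) \<le> opnorm (tjacobian A x) + L * r"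
      using B[OF \<open>u \<in> ball x r\<close>] opnorm_transpose[of "tjacobian A u"] by (simp add: opnorm_def)
  qed
  then show "\<exists>r>0. \<exists>L. \<forall>y\<in>ball x r. \<forall>z\<in>ball x r. norm (A y - A z) \<le> L * norm (y - z)"
    using r by blast
qed

section \<open>Feasible points near a given point\<close>

text \<open>
A quantitative form of the theorem of Lyusternik and Graves. With a right inverse \<open>B\<close> of the
derivative at \<open>x\<close>, the point \<open>y + B w\<close> is a zero of \<open>c\<close> iff \<open>w\<close> is a fixed point of
\<open>w \<mapsto> w - c (y + B w)\<close>. The derivative of this map is small near \<open>x\<close>; it is made at most \<open>1 / 2\<close>,
and the fixed point then lies within twice the size \<open>norm (c y)\<close> of the first step from \<open>0\<close>.
\<close>

lemma exists_zero_near: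
  fixes c :: "'a::euclidean_space \<Rightarrow> 'b::euclidean_space"
  assumes der: "\<And>y. (c has_derivative c' y) (at y)"
    and zero: "c x = 0"
    and cont: "\<And>e. e > 0 \<Longrightarrow> \<exists>d>0. \<forall>y\<in>ball x d. \<forall>v. norm (c' y v - c' x v) \<le> e * norm v"
    and B: "linear B" "\<And>w. c' x (B w) = w" "\<And>w. norm (B w) \<le> K * norm w" and K: "K > 0"
  shows "\<exists>d>0. \<forall>y\<in>ball x d. \<exists>z. c z = 0 \<and> norm (z - y) \<le> 2 * K * norm (c y)"
proof -
  obtain d where d: "d > 0"
    and half: "\<And>y v. y \<in> ball x d \<Longrightarrow> norm (c' y v - c' x v) \<le> (1 / (2 * K)) * norm v"
    using cont[of "1 / (2 * K)"] K by auto
  have "isCont c x" using der has_derivative_continuous by blast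
  then have "\<forall>\<^sub>F y in nhds x. dist (c y) (c x) < d / (4 * K)"
    using d K by (intro tendstoD) (auto simp: continuous_within tendsto_at_iff_tendsto_nhds[symmetric])
  then obtain e where e: "e > 0" "\<And>y. dist y x < e \<Longrightarrow> norm (c y) < d / (4 * K)"
    unfolding eventually_nhds_metric using zero by auto
  have "\<exists>z. c z = 0 \<and> norm (z - y) \<le> 2 * K * norm (c y)" if y: "y \<in> ball x (min e (d / 2))" for y
  proof -
    let ?S = "cball (0::'b) (2 * norm (c y))"
    let ?T = "\<lambda>w. w - c (y + B w)"
    have cy: "2 * K * norm (c y) < d / 2"
      using e(2)[of y] y K by (simp add: dist_commute field_simps)
    have Bw: "norm (B w) \<le> 2 * K * norm (c y)" if "w \<in> ?S" for w
      using order_trans[OF B(3)[of w] mult_left_mono[of "norm w" "2 * norm (c y)" K]] that K by simp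
    have in_ball: "y + B w \<in> ball x d" if "w \<in> ?S" for w
    proof -
      have "dist x (y + B w) \<le> dist x y + norm (B w)"
        using dist_triangle[of x "y + B w" y] by (simp add: dist_norm)
      then show ?thesis using Bw[OF that] y cy by simp
    qed
    have lB: "bounded_linear B" using B(1) by (simp add: linear_conv_bounded_linear)
    have contr: "norm (?T w - ?T u) \<le> 1 / 2 * norm (w - u)" if "w \<in> ?S" "u \<in> ?S" for w u
    proof (rule differentiable_bound[OF convex_cball _ _ that])
      fix v assume v: "v \<in> ?S"
      show "(?T has_derivative (\<lambda>h. h - c' (y + B v) (B h))) (at v within ?S)"
        by (rule derivative_eq_intros has_derivative_compose[OF _ der] refl
            bounded_linear.has_derivative[OF lB])+ simp
      show "onorm (\<lambda>h. h - c' (y + B v) (B h)) \<le> 1 / 2"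
      proof (rule onorm_le)
        fix h
        have "norm (h - c' (y + B v) (B h)) = norm (c' (y + B v) (B h) - c' x (B h))"
          by (simp add: B(2) norm_minus_commute)
        also have "\<dots> \<le> 1 / (2 * K) * norm (B h)" by (rule half[OF in_ball[OF v]])
        also have "\<dots> \<le> 1 / (2 * K) * (K * norm h)" using K by (intro mult_left_mono B(3)) auto
        finally show "norm (h - c' (y + B v) (B h)) \<le> 1 / 2 * norm h" using K by simp
      qed
    qed
    have "?T ` ?S \<subseteq> ?S"
    proof
      fix u assume "u \<in> ?T ` ?S"
      then obtain w where w: "w \<in> ?S" and u: "u = ?T w" by blast
      have "norm (?T w) \<le> norm (?T w - ?T 0) + norm (?T 0)"
        by (metis norm_triangle_sub add.commute)
      also have "\<dots> \<le> 1 / 2 * norm (w - 0) + norm (c y)"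
        using contr[OF w, of 0] linear_0[OF B(1)] by simp
      also have "\<dots> \<le> 2 * norm (c y)" using w by simp
      finally show "u \<in> ?S" by (simp add: u)
    qed
    moreover have "\<forall>w\<in>?S. \<forall>u\<in>?S. dist (?T w) (?T u) \<le> 1 / 2 * dist w u"
      using contr by (simp only: dist_norm) blast
    ultimately obtain w where w: "w \<in> ?S" "?T w = w"
      using Banach_fix[of ?S "1 / 2" ?T] by (auto simp: complete_eq_closed)
    then have "c (y + B w) = 0" "norm (y + B w - y) \<le> 2 * K * norm (c y)" using Bw by auto
    then show ?thesis by blast
  qed
  moreover have "min e (d / 2) > 0" using e d by simp
  ultimately show ?thesis by blast
qed

lemma invertible_gram:
  fixes J :: "real^'p^'n"
  assumes "rank J = CARD('p)"
  shows "invertible (transpose J ** J)"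
proof -
  have "v = 0" if "(transpose J ** J) *v v = 0" for v
  proof -
    have "(norm (J *v v))\<^sup>2 = v \<bullet> ((transpose J ** J) *v v)"
      by (simp add: power2_norm_eq_inner matrix_vector_mul_assoc[symmetric] inner_commute[of v])
    then have "J *v v = J *v 0" using that by simp
    then show "v = 0" using assms full_rank_injective inj_eq by metis
  qed
  then show ?thesis by (metis invertible_left_inverse matrix_left_invertible_ker)
qed

lemma mult_matrix_inv:
  assumes "invertible M"
  shows "M ** matrix_inv M = mat 1"
  using assms unfolding invertible_def matrix_inv_def by (metis (mono_tags, lifting) someI_ex)

lemma transpose_mult_pseudoinverse:
  fixes J :: "real^'p^'n"
  assumes "rank J = CARD('p)"
  shows "transpose J *v (J *v (matrix_inv (transpose J ** J) *v w)) = w"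
  by (simp add: matrix_vector_mul_assoc matrix_mul_assoc mult_matrix_inv[OF invertible_gram[OF assms]])

text \<open>
The right inverse of \<open>transpose J\<close> given by the normal equations has norm at most the reciprocal of
the least singular value: with \<open>u\<close> the solution of the normal equations for \<open>w\<close>, \<open>(norm (J *v u))\<^sup>2\<close>
equals \<open>u \<bullet> w\<close>, and \<open>norm u\<close> is at most \<open>norm (J *v u) / sigma_min J\<close>.
\<close>

lemma norm_pseudoinverse_le:
  fixes J :: "real^'p^'n"
  assumes rank: "rank J = CARD('p)"
  shows "norm (J *v (matrix_inv (transpose J ** J) *v w)) \<le> 1 / sigma_min J * norm w"
proof -
  define u where "u = matrix_inv (transpose J ** J) *v w"
  have le: "CARD('p) \<le> CARD('n)" using rank_bound[of J] rank by simp
  have s: "sigma_min J > 0" using rank by (rule sigma_min_pos)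
  have "(norm (J *v u))\<^sup>2 = u \<bullet> w"
    using transpose_mult_pseudoinverse[OF rank, of w] unfolding u_def[symmetric]
    by (metis inner_commute inner_transpose_mult power2_norm_eq_inner)
  also have "\<dots> \<le> norm u * norm w" by (rule norm_cauchy_schwarz)
  also have "\<dots> \<le> norm (J *v u) / sigma_min J * norm w"
    using sigma_min_mult_le[OF le, of J u] s by (intro mult_right_mono) (auto simp: field_simps)
  finally have "norm (J *v u) * norm (J *v u) \<le> (1 / sigma_min J * norm w) * norm (J *v u)"
    by (simp add: power2_eq_square mult_ac)
  then show ?thesis
    unfolding u_def[symmetric] by (rule le_of_square_le_mult) (use s in simp_all)
qed

lemma exists_feasible_near:
  fixes c :: "real^'n \<Rightarrow> real^'p"
  assumes diff: "\<And>y. c differentiable (at y)" and lip: "locally_lipschitz opnorm (tjacobian c)"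
    and x: "x \<in> feasible_set c" and rank: "rank (tjacobian c x) = CARD('p)" and e: "e > 0"
  shows "\<exists>d>0. \<forall>y\<in>ball x d. \<exists>z\<in>feasible_set c.
    z \<in> ball x e \<and> norm (z - y) \<le> 2 / sigma_min (tjacobian c x) * norm (c y)"
proof -
  let ?J = "tjacobian c"
  let ?s = "sigma_min (?J x)"
  let ?B = "\<lambda>w. ?J x *v (matrix_inv (transpose (?J x) ** ?J x) *v w)"
  have s: "?s > 0" using rank by (rule sigma_min_pos)
  have cx: "c x = 0" using x by (simp add: feasible_set_def)
  obtain r L where r: "r > 0" "L \<ge> 0" and
    L: "\<And>y z. y \<in> ball x r \<Longrightarrow> z \<in> ball x r \<Longrightarrow> opnorm (?J y - ?J z) \<le> L * norm (y - z)"
    using locally_lipschitzE[OF lip, of x] by metis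
  have "\<exists>d>0. \<forall>y\<in>ball x d. \<exists>z. c z = 0 \<and> norm (z - y) \<le> 2 * (1 / ?s) * norm (c y)"
  proof (rule exists_zero_near[of c "\<lambda>y v. transpose (?J y) *v v" x ?B])
    show "(c has_derivative (\<lambda>v. transpose (?J y) *v v)) (at y)" for y
      by (rule has_derivative_tjacobian[OF diff])
    show "linear ?B"
      by (intro linear_compose[OF matrix_vector_mul_linear matrix_vector_mul_linear, unfolded o_def])
    show "transpose (?J x) *v ?B w = w" for w by (rule transpose_mult_pseudoinverse[OF rank])
    show "norm (?B w) \<le> 1 / ?s * norm w" for w by (rule norm_pseudoinverse_le[OF rank])
    fix \<epsilon> :: real assume \<epsilon>: "\<epsilon> > 0"
    define d where "d = min r (\<epsilon> / (L + 1))"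
    have "norm (transpose (?J y) *v v - transpose (?J x) *v v) \<le> \<epsilon> * norm v" if y: "y \<in> ball x d" for y v
    proof -
      have "transpose (?J y) *v v - transpose (?J x) *v v = transpose (?J y - ?J x) *v v"
        by (simp add: matrix_vector_mult_def transpose_def vec_eq_iff left_diff_distrib sum_subtractf)
      then have "norm (transpose (?J y) *v v - transpose (?J x) *v v) \<le> opnorm (?J y - ?J x) * norm v"
        by (metis norm_mult_le_opnorm opnorm_transpose)
      also have "\<dots> \<le> \<epsilon> * norm v"
      proof (rule mult_right_mono)
        have "opnorm (?J y - ?J x) \<le> L * norm (y - x)" using y r by (intro L) (auto simp: d_def)
        also have "\<dots> \<le> (L + 1) * (\<epsilon> / (L + 1))"
          using y r by (intro mult_mono) (auto simp: d_def dist_norm norm_minus_commute)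
        finally show "opnorm (?J y - ?J x) \<le> \<epsilon>" using r by simp
      qed simp
      finally show ?thesis .
    qed
    moreover have "d > 0" using r \<epsilon> by (simp add: d_def)
    ultimately show "\<exists>d>0. \<forall>y\<in>ball x d. \<forall>v.
        norm (transpose (?J y) *v v - transpose (?J x) *v v) \<le> \<epsilon> * norm v" by blast
  qed (use cx s in auto)
  then obtain d where d: "d > 0"
    and zero: "\<And>y. y \<in> ball x d \<Longrightarrow> \<exists>z. c z = 0 \<and> norm (z - y) \<le> 2 / ?s * norm (c y)"
    by auto
  have "isCont c x" using diff differentiable_imp_continuous_within by blast
  then obtain d' where d': "d' > 0" "\<And>y. dist y x < d' \<Longrightarrow> norm (c y) < e * ?s / 4"
    using cx s e unfolding continuous_at_eps_delta by (metis divide_pos_pos dist_0_norm dist_commute mult_pos_pos zero_less_numeral)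
  have "\<exists>z\<in>feasible_set c. z \<in> ball x e \<and> norm (z - y) \<le> 2 / ?s * norm (c y)"
    if y: "y \<in> ball x (min d (min d' (e / 2)))" for y
  proof -
    obtain z where z: "c z = 0" "norm (z - y) \<le> 2 / ?s * norm (c y)" using zero[of y] y by auto
    have "2 / ?s * norm (c y) < e / 2" using d'(2)[of y] y s by (simp add: dist_commute field_simps)
    then have "dist y z < e / 2" using z(2) by (simp add: dist_norm norm_minus_commute)
    then have "z \<in> ball x e" using y dist_triangle[of x z y] by simp
    then show ?thesis using z by (auto simp: feasible_set_def)
  qed
  then show ?thesis using d d' e by (intro exI[of _ "min d (min d' (e / 2))"]) auto
qed

section \<open>The derivative of the constraint dissolving map\<close>

text \<open>
Along the line through \<open>z\<close> in direction \<open>v\<close> the function \<open>c\<close> is of lower order than the step, and it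
dominates \<open>\<psi>\<close>. With \<open>\<psi> y = A y - y\<close> this yields the action of the derivative of \<open>A\<close> on the
kernel of the derivative of \<open>c\<close> without any parametrization of the feasible set by curves.
\<close>

lemma derivative_vanishes_of_norm_le:
  fixes \<psi> :: "'a::real_normed_vector \<Rightarrow> 'b::real_normed_vector" and c :: "'a \<Rightarrow> 'c::real_normed_vector"
  assumes \<psi>: "(\<psi> has_derivative \<psi>') (at z)" and c: "(c has_derivative c') (at z)"
    and zero: "c z = 0" and d: "d > 0" and le: "\<And>y. y \<in> ball z d \<Longrightarrow> norm (\<psi> y) \<le> C * norm (c y)"
    and v: "c' v = 0"
  shows "\<psi>' v = 0"
proof -
  have quot: "((\<lambda>t. (1 / t) *\<^sub>R g (z + t *\<^sub>R v)) \<longlongrightarrow> g' v) (at 0)"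
    if g: "(g has_derivative g') (at z)" and g0: "g z = 0"
    for g :: "'a \<Rightarrow> 'd::real_normed_vector" and g'
  proof -
    have "((\<lambda>t. z + t *\<^sub>R v) has_derivative (\<lambda>t. t *\<^sub>R v)) (at 0)"
      by (auto intro!: derivative_eq_intros)
    then have "((\<lambda>t. g (z + t *\<^sub>R v)) has_derivative (\<lambda>t. g' (t *\<^sub>R v))) (at 0)"
      by (rule has_derivative_compose) (simp add: g)
    then have lim: "(\<lambda>t. norm (g (z + t *\<^sub>R v) - t *\<^sub>R g' v) / norm t) \<midarrow>0\<rightarrow> 0"
      using g0 by (simp add: has_derivative_at linear_cmul[OF has_derivative_linear[OF g]])
    have "((\<lambda>t. (1 / t) *\<^sub>R g (z + t *\<^sub>R v) - g' v) \<longlongrightarrow> 0) (at 0)"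
    proof (rule Lim_null_comparison[OF _ lim])
      have "norm ((1 / t) *\<^sub>R g (z + t *\<^sub>R v) - g' v) = norm (g (z + t *\<^sub>R v) - t *\<^sub>R g' v) / norm t"
        if "t \<noteq> 0" for t
      proof -
        have "(1 / t) *\<^sub>R g (z + t *\<^sub>R v) - g' v = (1 / t) *\<^sub>R (g (z + t *\<^sub>R v) - t *\<^sub>R g' v)"
          using that by (simp add: scaleR_diff_right)
        then show ?thesis by simp
      qed
      then show "\<forall>\<^sub>F t in at 0. norm ((1 / t) *\<^sub>R g (z + t *\<^sub>R v) - g' v)
          \<le> norm (g (z + t *\<^sub>R v) - t *\<^sub>R g' v) / norm t"
        by (intro eventually_at_filter[THEN iffD2] always_eventually) (metis order_refl)
    qed
    then show ?thesis using Lim_null by blast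
  qed
  have "norm (\<psi> z) \<le> C * norm (c z)" using d by (intro le) simp
  then have \<psi>0: "\<psi> z = 0" using zero by simp
  have "((\<lambda>t. (1 / t) *\<^sub>R \<psi> (z + t *\<^sub>R v)) \<longlongrightarrow> 0) (at 0)"
  proof (rule Lim_null_comparison)
    show "((\<lambda>t. C * norm ((1 / t) *\<^sub>R c (z + t *\<^sub>R v))) \<longlongrightarrow> 0) (at 0)"
      using tendsto_mult_left[OF tendsto_norm[OF quot[OF c zero]], of C] v by simp
    have "((\<lambda>t. z + t *\<^sub>R v) \<longlongrightarrow> z) (at 0)"
      by (auto intro!: tendsto_eq_intros)
    then have "\<forall>\<^sub>F t in at 0. z + t *\<^sub>R v \<in> ball z d"
      using d by (intro topological_tendstoD) auto
    then show "\<forall>\<^sub>F t in at 0. norm ((1 / t) *\<^sub>R \<psi> (z + t *\<^sub>R v)) \<le> C * norm ((1 / t) *\<^sub>R c (z + t *\<^sub>R v))"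
    proof eventually_elim
      case (elim t)
      have "\<bar>1 / t\<bar> * norm (\<psi> (z + t *\<^sub>R v)) \<le> \<bar>1 / t\<bar> * (C * norm (c (z + t *\<^sub>R v)))"
        by (intro mult_left_mono le elim) simp
      then show ?case by (simp add: mult_ac)
    qed
  qed
  then show ?thesis using quot[OF \<psi> \<psi>0] tendsto_unique[OF at_neq_bot] by blast
qed

text \<open>
A point \<open>y\<close> near \<open>z\<close> has a fixed point \<open>w\<close> of \<open>A\<close> within a distance of order \<open>norm (c y)\<close>. As \<open>A\<close> is
Lipschitz near \<open>z\<close>, the displacement \<open>A y - y\<close> is of that order too.
\<close>

lemma derivative_fixes_tangent:
  fixes c :: "real^'n \<Rightarrow> real^'p" and A :: "real^'n \<Rightarrow> real^'n"
  assumes c_diff: "\<And>y. c differentiable (at y)" and Jc_lip: "locally_lipschitz opnorm (tjacobian c)"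
    and rank: "rank (tjacobian c z) = CARD('p)"
    and A_diff: "\<And>y. A differentiable (at y)" and JA_lip: "locally_lipschitz opnorm (tjacobian A)"
    and A_fix: "\<And>y. y \<in> feasible_set c \<Longrightarrow> A y = y"
    and z: "z \<in> feasible_set c" and v: "transpose (tjacobian c z) *v v = 0"
  shows "transpose (tjacobian A z) *v v = v"
proof -
  obtain r L where r: "r > 0" "L \<ge> 0" and
    L: "\<And>y w. y \<in> ball z r \<Longrightarrow> w \<in> ball z r \<Longrightarrow> norm (A y - A w) \<le> L * norm (y - w)"
    using locally_lipschitzE[OF locally_lipschitz_of_tjacobian[OF A_diff JA_lip], of z] by metis
  let ?K = "2 / sigma_min (tjacobian c z)"
  obtain d where d: "d > 0" and near: "\<And>y. y \<in> ball z d \<Longrightarrow>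
      \<exists>w\<in>feasible_set c. w \<in> ball z r \<and> norm (w - y) \<le> ?K * norm (c y)"
    using exists_feasible_near[OF c_diff Jc_lip z rank r(1)] by blast
  have "transpose (tjacobian A z) *v v - v = 0"
  proof (rule derivative_vanishes_of_norm_le[where z = z and c = c and v = v and \<psi> = "\<lambda>y. A y - y"
        and \<psi>' = "\<lambda>v. transpose (tjacobian A z) *v v - v" and c' = "\<lambda>v. transpose (tjacobian c z) *v v"
        and d = "min d r" and C = "(L + 1) * ?K"])
    show "((\<lambda>y. A y - y) has_derivative (\<lambda>v. transpose (tjacobian A z) *v v - v)) (at z)"
      by (intro has_derivative_diff has_derivative_tjacobian A_diff has_derivative_ident)
    show "(c has_derivative (\<lambda>v. transpose (tjacobian c z) *v v)) (at z)"
      by (rule has_derivative_tjacobian[OF c_diff])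
    fix y assume y: "y \<in> ball z (min d r)"
    then obtain w where w: "w \<in> feasible_set c" "w \<in> ball z r" "norm (w - y) \<le> ?K * norm (c y)"
      using near by auto
    have "A y - y = (A y - A w) + (w - y)" using A_fix[OF w(1)] by simp
    then have "norm (A y - y) \<le> norm (A y - A w) + norm (w - y)" by (metis norm_triangle_ineq)
    also have "\<dots> \<le> (L + 1) * norm (w - y)"
      using L[of y w] y w(2) by (simp add: norm_minus_commute algebra_simps)
    also have "\<dots> \<le> (L + 1) * (?K * norm (c y))" using w(3) r by (intro mult_left_mono) auto
    finally show "norm (A y - y) \<le> (L + 1) * ?K * norm (c y)" by (simp only: mult.assoc)
  qed (use z v d r in \<open>auto simp: feasible_set_def\<close>)
  then show ?thesis by simp
qed

text \<open>
Transposed, \<open>J ** G = 0\<close> says that the derivative of \<open>A\<close> maps into the tangent space, on which it is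
the identity.
\<close>

lemma tjacobian_idempotent:
  fixes c :: "real^'n \<Rightarrow> real^'p" and A :: "real^'n \<Rightarrow> real^'n"
  assumes fix_tangent: "\<And>v. transpose (tjacobian c z) *v v = 0 \<Longrightarrow> transpose (tjacobian A z) *v v = v"
    and JA_Jc: "tjacobian A z ** tjacobian c z = 0"
  shows "tjacobian A z ** tjacobian A z = tjacobian A z"
proof -
  let ?T = "transpose (tjacobian A z)"
  have "transpose (tjacobian c z) ** ?T = 0"
    using arg_cong[OF JA_Jc, of transpose] by (simp add: matrix_transpose_mul)
      (simp add: transpose_def vec_eq_iff)
  then have "transpose (tjacobian c z) *v (?T *v v) = 0" for v
    by (simp add: matrix_vector_mul_assoc)
  then have "?T *v (?T *v v) = ?T *v v" for v by (rule fix_tangent)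
  then have "?T ** ?T = ?T" by (simp add: matrix_eq matrix_vector_mul_assoc)
  then have "transpose (tjacobian A z ** tjacobian A z) = ?T" by (simp add: matrix_transpose_mul)
  then show ?thesis by (metis transpose_transpose)
qed

text \<open>
The Riemannian gradient \<open>r\<close> is tangent, and \<open>grad f z - r\<close> is normal. Hence the inner product of \<open>r\<close>
with \<open>tjacobian A z *v grad f z\<close> is \<open>r \<bullet> grad f z = r \<bullet> r\<close>.
\<close>

lemma norm_riem_grad_le:
  fixes c :: "real^'n \<Rightarrow> real^'p" and A :: "real^'n \<Rightarrow> real^'n"
  assumes fix_tangent: "\<And>v. transpose (tjacobian c z) *v v = 0 \<Longrightarrow> transpose (tjacobian A z) *v v = v"
    and rank: "rank (tjacobian c z) = CARD('p)"
  shows "norm (riem_grad f c z) \<le> norm (tjacobian A z *v grad f z)"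
proof -
  let ?r = "riem_grad f c z"
  have tangent: "transpose (tjacobian c z) *v ?r = 0"
    using transpose_mult_pseudoinverse[OF rank]
    by (simp add: riem_grad_def multiplier_def matrix_vector_mult_diff_distrib)
  \<comment> \<open>The second summand is normal, that is, orthogonal to every tangent vector.\<close>
  have split: "grad f z = ?r + tjacobian c z *v multiplier f c z"
    by (simp add: riem_grad_def)
  have "?r \<bullet> (tjacobian A z *v grad f z) = (transpose (tjacobian A z) *v ?r) \<bullet> grad f z"
    by simp
  also have "\<dots> = ?r \<bullet> grad f z" using fix_tangent[OF tangent] by simp
  also have "\<dots> = ?r \<bullet> ?r + (transpose (tjacobian c z) *v ?r) \<bullet> multiplier f c z"
    using arg_cong[OF split, of "\<lambda>u. ?r \<bullet> u"] by (simp add: inner_add_right)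
  also have "\<dots> = (norm ?r)\<^sup>2" by (simp add: tangent power2_norm_eq_inner)
  finally have "norm ?r * norm ?r \<le> norm (tjacobian A z *v grad f z) * norm ?r"
    using norm_cauchy_schwarz[of ?r "tjacobian A z *v grad f z"] by (simp add: power2_eq_square mult_ac)
  then show ?thesis by (rule le_of_square_le_mult) simp_all
qed

section \<open>The penalty gradient controls the constraint violation\<close>

text \<open>
The gradient of the penalty function is multiplied by \<open>Q = mat 1 - J y\<close>. In the component
that comes from \<open>g = grad f (A y)\<close>,
\<open>Q ** J y = J y - J y ** J y\<close> vanishes at the feasible point \<open>w\<close> near \<open>y\<close>, and its size is therefore at
most \<open>LA * (2 * MA + 1) * norm (y - w)\<close>; together with \<open>norm g \<le> Mf\<close> and the hypothesis on \<open>\<beta>\<close> this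
leaves at most \<open>\<beta> * s / 8 * norm (c y)\<close>. The penalty component, in contrast, has norm at least
\<open>\<beta> * s / 2 * norm (c y)\<close>, because \<open>Q ** G y\<close> is close to \<open>(mat 1 - J x) ** G x = G x\<close>.
\<close>

lemma norm_constraint_le_grad_penalty:
  fixes f :: "real^'n \<Rightarrow> real" and c :: "real^'n \<Rightarrow> real^'p" and A :: "real^'n \<Rightarrow> real^'n"
  assumes f_diff: "\<And>y. f differentiable (at y)"
    and c_diff: "\<And>y. c differentiable (at y)"
    and grad_f_lip: "locally_lipschitz norm (grad f)"
    and Jc_lip: "locally_lipschitz opnorm (tjacobian c)"
    and rank: "rank (tjacobian c x) = CARD('p)"
    and A_diff: "\<And>y. A differentiable (at y)"
    and JA_lip: "locally_lipschitz opnorm (tjacobian A)"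
    and JA_idem: "\<And>y. y \<in> feasible_set c \<Longrightarrow> tjacobian A y ** tjacobian A y = tjacobian A y"
    and JA_Jc: "tjacobian A x ** tjacobian c x = 0"
    and x: "x \<in> feasible_set c"
    and \<beta>: "\<beta> > 0" "\<beta> \<ge> beta_bound f c A x"
  shows "\<exists>K\<ge>0. \<exists>d>0. \<forall>y\<in>ball x d. norm (c y) \<le> K * norm (grad (penalty_fun f c A \<beta>) y)"
proof -
  define s where "s = sigma_min (tjacobian c x)"
  define S where "S = Theta c x"
  define Mf where "Mf = (SUP y\<in>S. norm (grad f (A y)))"
  define MA where "MA = (SUP y\<in>S. opnorm (tjacobian A y))"
  define LA where "LA = lip_const opnorm S (tjacobian A)"
  define J where "J = tjacobian A"
  define G where "G = tjacobian c"
  have le: "CARD('p) \<le> CARD('n)" using rank_bound[of "tjacobian c x"] rank by simp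
  have s: "s > 0" unfolding s_def using rank by (rule sigma_min_pos)
  have rho: "rho c x > 0" using rho_pos[OF le Jc_lip] s by (simp add: s_def)
  have S: "compact S" "x \<in> S" "ball x (rho c x) \<subseteq> S"
    using rho by (auto simp: S_def Theta_def)
  have \<beta>_third: "16 * Mf * LA * (2 * MA + 1) / s\<^sup>2 \<le> \<beta>"
  proof -
    have "16 * Mf * LA * (2 * MA + 1) / s\<^sup>2 \<le> beta_bound f c A x"
      unfolding beta_bound_def Let_def Mf_def LA_def MA_def s_def S_def by (rule Max_ge) auto
    then show ?thesis using \<beta> by simp
  qed
  then have "16 * Mf * LA * (2 * MA + 1) \<le> \<beta> * s\<^sup>2"
    using s by (simp only: pos_divide_le_eq zero_less_power)
  then have \<beta>_third': "Mf * LA * (2 * MA + 1) \<le> \<beta> * s\<^sup>2 / 16" by simp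
  have A_lip: "locally_lipschitz norm A" by (rule locally_lipschitz_of_tjacobian[OF A_diff JA_lip])
  have "continuous_on S (\<lambda>y. grad f (A y))"
    using locally_lipschitz_compose[OF A_lip grad_f_lip]
      continuous_on_of_locally_lipschitz[where \<phi> = "\<lambda>u. u"] by fastforce
  then have "bdd_above ((\<lambda>y. norm (grad f (A y))) ` S)"
    using S by (intro bounded_imp_bdd_above compact_imp_bounded compact_continuous_image continuous_on_norm)
  then have Mf: "norm (grad f (A y)) \<le> Mf" if "y \<in> S" for y
    unfolding Mf_def using that by (intro cSUP_upper)
  have "bdd_above ((\<lambda>y. opnorm (tjacobian A y)) ` S)"
    using S JA_lip norm_opnorm_diff_le
    by (intro bounded_imp_bdd_above compact_imp_bounded compact_continuous_image
        continuous_on_of_locally_lipschitz)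
  then have MA: "opnorm (J y) \<le> MA" if "y \<in> S" for y
    unfolding MA_def J_def using that by (intro cSUP_upper)
  have LA: "opnorm (J y - J w) \<le> LA * norm (y - w)" if "y \<in> S" "w \<in> S" for y w
    unfolding LA_def J_def by (rule opnorm_diff_le_lip_const[OF JA_lip S(1) that])
  have Mf0: "Mf \<ge> 0" using Mf[OF S(2)] norm_ge_zero order_trans by blast
  have MA0: "MA \<ge> 0" using MA[OF S(2)] opnorm_nonneg[of "J x"] by linarith
  obtain r L where r: "r > 0" "L \<ge> 0" and
    L: "\<And>y w. y \<in> ball x r \<Longrightarrow> w \<in> ball x r \<Longrightarrow> opnorm (J y - J w) \<le> L * norm (y - w)"
    using locally_lipschitzE[OF JA_lip, of x] unfolding J_def by metis
  obtain r' L' where r': "r' > 0" "L' \<ge> 0" and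
    L': "\<And>y w. y \<in> ball x r' \<Longrightarrow> w \<in> ball x r' \<Longrightarrow> opnorm (G y - G w) \<le> L' * norm (y - w)"
    using locally_lipschitzE[OF Jc_lip, of x] unfolding G_def by metis
  \<comment> \<open>The constant in the bound \<open>E * norm (y - x)\<close> for the deviation of \<open>Q ** G y\<close> from \<open>G x\<close>.\<close>
  define E where "E = (1 + MA) * L' + L * opnorm (G x)"
  have E: "E \<ge> 0" unfolding E_def using MA0 r r' by (simp add: opnorm_nonneg)
  obtain d where d: "d > 0" and near: "\<And>y. y \<in> ball x d \<Longrightarrow>
      \<exists>w\<in>feasible_set c. w \<in> ball x (rho c x) \<and> norm (w - y) \<le> 2 / s * norm (c y)"
    using exists_feasible_near[OF c_diff Jc_lip x rank rho] unfolding s_def by blast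
  \<comment> \<open>The last radius makes this deviation at most half of \<open>s\<close>.\<close>
  define t where "t = Min {d, rho c x, r, r', s / (2 * (E + 1))}"
  have t: "t > 0" unfolding t_def using d rho r r' s E by simp
  have t_le: "t \<le> d" "t \<le> rho c x" "t \<le> r" "t \<le> r'" "t \<le> s / (2 * (E + 1))"
    unfolding t_def by (rule Min_le; simp)+
  have "norm (c y) \<le> (8 * (1 + MA) / (3 * \<beta> * s)) * norm (grad (penalty_fun f c A \<beta>) y)"
    if y: "y \<in> ball x t" for y
  proof -
    define g where "g = grad f (A y)"
    define Q where "Q = mat 1 - J y"
    have yS: "y \<in> S" using y t_le S by auto
    obtain w where w: "w \<in> feasible_set c" "w \<in> S" "norm (w - y) \<le> 2 / s * norm (c y)"
      using near[of y] y t_le S by auto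
    have yx: "norm (y - x) < t" using y by (simp add: dist_norm norm_minus_commute)
    have grad_h: "grad (penalty_fun f c A \<beta>) y = J y *v g + \<beta> *\<^sub>R (G y *v c y)"
      unfolding J_def G_def g_def by (rule grad_eqI[OF has_derivative_penalty_fun[OF A_diff f_diff c_diff]])
    have defect: "norm (Q *v (J y *v g)) \<le> \<beta> * s / 8 * norm (c y)"
    proof -
      let ?D = "J y - J w"
      have idem: "J w *v (J w *v u) = J w *v u" for u
        using JA_idem[OF w(1)] by (simp add: J_def matrix_vector_mul_assoc)
      have "Q *v (J y *v g) = ?D *v g - J y *v (?D *v g) - ?D *v (J w *v g)"
        by (simp add: Q_def matrix_vector_mult_diff_rdistrib matrix_vector_mult_diff_distrib idem)
      also have "norm \<dots> \<le> norm (?D *v g) + norm (J y *v (?D *v g)) + norm (?D *v (J w *v g))"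
        by (meson add_right_mono norm_triangle_ineq4 order_trans)
      also have "\<dots> \<le> opnorm ?D * norm g + MA * (opnorm ?D * norm g) + opnorm ?D * (MA * norm g)"
        using MA0 MA[OF yS] MA[OF w(2)]
        by (intro add_mono norm_mult_le_opnorm order_trans[OF norm_mult_le_opnorm] mult_mono
            mult_right_mono mult_nonneg_nonneg opnorm_nonneg order_refl norm_ge_zero)
      also have "\<dots> = opnorm ?D * (norm g * (2 * MA + 1))" by (simp add: algebra_simps)
      also have "\<dots> \<le> (LA * norm (y - w)) * (Mf * (2 * MA + 1))"
        using LA[OF yS w(2)] Mf[OF yS] Mf0 MA0 order_trans[OF opnorm_nonneg LA[OF yS w(2)]]
        by (intro mult_mono) (auto simp: g_def)
      also have "\<dots> = (Mf * LA * (2 * MA + 1)) * norm (w - y)"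
        by (simp only: norm_minus_commute[of w y] mult_ac)
      also have "\<dots> \<le> (\<beta> * s\<^sup>2 / 16) * norm (w - y)"
        using \<beta>_third' by (intro mult_right_mono) simp_all
      also have "\<dots> \<le> (\<beta> * s\<^sup>2 / 16) * (2 / s * norm (c y))"
        using w(3) \<beta> by (intro mult_left_mono) auto
      also have "\<dots> = \<beta> * s / 8 * norm (c y)" using s by (simp add: power2_eq_square field_simps)
      finally show ?thesis .
    qed
    have normal: "s / 2 * norm v \<le> norm (Q *v (G y *v v))" for v
    proof -
      have "J x *v (G x *v v) = 0" using JA_Jc by (simp add: J_def G_def matrix_vector_mul_assoc)
      then have "G x *v v = Q *v (G y *v v) - (Q *v ((G y - G x) *v v) - (J y - J x) *v (G x *v v))"
        by (simp add: Q_def matrix_vector_mult_diff_rdistrib matrix_vector_mult_diff_distrib)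
      then have "norm (G x *v v) \<le> norm (Q *v (G y *v v))
          + norm (Q *v ((G y - G x) *v v) - (J y - J x) *v (G x *v v))"
        by (metis norm_triangle_ineq4)
      moreover have "norm (Q *v ((G y - G x) *v v) - (J y - J x) *v (G x *v v)) \<le> s / 2 * norm v"
      proof -
        have "norm (Q *v ((G y - G x) *v v) - (J y - J x) *v (G x *v v))
            \<le> norm (Q *v ((G y - G x) *v v)) + norm ((J y - J x) *v (G x *v v))"
          by (rule norm_triangle_ineq4)
        also have "\<dots> \<le> opnorm Q * (opnorm (G y - G x) * norm v) + opnorm (J y - J x) * (opnorm (G x) * norm v)"
          by (intro add_mono order_trans[OF norm_mult_le_opnorm] mult_left_mono norm_mult_le_opnorm opnorm_nonneg)
        also have "\<dots> \<le> (1 + MA) * ((L' * t) * norm v) + (L * t) * (opnorm (G x) * norm v)"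
        proof (intro add_mono mult_mono mult_right_mono)
          show "opnorm Q \<le> 1 + MA" unfolding Q_def using opnorm_mat_1_minus_le[of "J y"] MA[OF yS] by simp
          have "opnorm (G y - G x) \<le> L' * norm (y - x)" using y t_le r' by (intro L') auto
          also have "\<dots> \<le> L' * t" using yx r' by (intro mult_left_mono) auto
          finally show "opnorm (G y - G x) \<le> L' * t" .
          have "opnorm (J y - J x) \<le> L * norm (y - x)" using y t_le r by (intro L) auto
          also have "\<dots> \<le> L * t" using yx r by (intro mult_left_mono) auto
          finally show "opnorm (J y - J x) \<le> L * t" .
        qed (use MA0 r r' t in \<open>auto simp: opnorm_nonneg\<close>)
        also have "\<dots> = (E * t) * norm v" by (simp add: E_def algebra_simps)
        also have "\<dots> \<le> s / 2 * norm v"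
        proof (rule mult_right_mono)
          have "E * t \<le> (E + 1) * (s / (2 * (E + 1)))" using t_le(5) E t by (intro mult_mono) auto
          also have "\<dots> = s / 2" using E by (simp add: field_simps)
          finally show "E * t \<le> s / 2" .
        qed simp
        finally show ?thesis .
      qed
      moreover have "s * norm v \<le> norm (G x *v v)"
        unfolding s_def G_def by (rule sigma_min_mult_le[OF le])
      ultimately show ?thesis by simp
    qed
    have "Q *v grad (penalty_fun f c A \<beta>) y = \<beta> *\<^sub>R (Q *v (G y *v c y)) + Q *v (J y *v g)"
      unfolding grad_h by (simp add: matrix_vector_right_distrib matrix_vector_mult_scaleR)
    then have "\<beta> * norm (Q *v (G y *v c y)) \<le> norm (Q *v grad (penalty_fun f c A \<beta>) y) + norm (Q *v (J y *v g))"
      using \<beta> norm_triangle_ineq4[of "Q *v grad (penalty_fun f c A \<beta>) y" "Q *v (J y *v g)"] by simp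
    moreover have "\<beta> * (s / 2 * norm (c y)) \<le> \<beta> * norm (Q *v (G y *v c y))"
      using \<beta> normal[of "c y"] by (intro mult_left_mono) auto
    moreover have "norm (Q *v grad (penalty_fun f c A \<beta>) y) \<le> (1 + MA) * norm (grad (penalty_fun f c A \<beta>) y)"
      using opnorm_mat_1_minus_le[of "J y"] MA[OF yS]
      by (intro order_trans[OF norm_mult_le_opnorm] mult_right_mono) (auto simp: Q_def)
    ultimately have "(3 * \<beta> * s / 8) * norm (c y) \<le> (1 + MA) * norm (grad (penalty_fun f c A \<beta>) y)"
      using defect by (simp add: field_simps)
    then show ?thesis using \<beta> s by (simp add: field_simps)
  qed
  moreover have "8 * (1 + MA) / (3 * \<beta> * s) \<ge> 0" using MA0 \<beta> s by simp
  ultimately show ?thesis using t by blast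
qed

section \<open>The Lojasiewicz inequality for the penalty function\<close>

text \<open>
For \<open>N \<le> 1\<close> the condition \<open>1 / 2 \<le> q\<close> gives \<open>(N\<^sup>2) powr q \<le> N\<close>, so that a quadratic term is harmless
after raising to the power \<open>q\<close>. For \<open>N > 1\<close> the bound \<open>\<Delta> \<le> 1\<close> suffices.
\<close>

lemma powr_le_linear_of_split:
  fixes N K M C a b \<Delta> q :: real
  assumes q: "1 / 2 \<le> q" "q \<le> 1" and N: "0 \<le> N" and \<Delta>: "0 \<le> \<Delta>" "\<Delta> \<le> 1" "\<Delta> \<le> a + b"
    and a: "0 \<le> a" "a \<le> K * N\<^sup>2" and b: "0 \<le> b" "C * b powr q \<le> M * N"
    and pos: "0 \<le> K" "0 \<le> M" "0 < C"
  shows "\<Delta> powr q \<le> (2 * (K powr q + M / C) + 1) * N"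
proof (cases "N \<le> 1")
  case True
  have "(N\<^sup>2) powr q = N powr (2 * q)" using N by (simp add: powr_powr[symmetric] powr_numeral)
  also have "\<dots> \<le> N powr 1" using q N True by (intro powr_mono') auto
  finally have Nq: "(N\<^sup>2) powr q \<le> N" using N by simp
  have "a powr q \<le> (K * N\<^sup>2) powr q" using a q by (intro powr_mono2) auto
  also have "\<dots> = K powr q * (N\<^sup>2) powr q" using pos by (simp add: powr_mult)
  also have "\<dots> \<le> K powr q * N" using Nq by (intro mult_left_mono) auto
  finally have aq: "a powr q \<le> K powr q * N" .
  have bq: "b powr q \<le> M / C * N" using b pos by (simp add: field_simps)
  have "\<Delta> powr q \<le> (2 * max a b) powr q" using \<Delta> q by (intro powr_mono2) auto
  also have "\<dots> = 2 powr q * max a b powr q" using a by (simp add: powr_mult)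
  also have "\<dots> \<le> 2 * (a powr q + b powr q)"
  proof (intro mult_mono)
    show "2 powr q \<le> (2::real)" using powr_mono[of q 1 2] q by simp
    show "max a b powr q \<le> a powr q + b powr q" by (simp add: max_def)
  qed auto
  also have "\<dots> \<le> 2 * ((K powr q + M / C) * N)" using aq bq by (simp add: distrib_right)
  finally show ?thesis using N by (simp add: algebra_simps)
next
  case False
  have "\<Delta> powr q \<le> 1" using \<Delta> q by (simp add: powr_le1)
  also have "\<dots> \<le> 1 * N" using False by simp
  also have "\<dots> \<le> (2 * (K powr q + M / C) + 1) * N" using N pos by (intro mult_right_mono) auto
  finally show ?thesis .
qed

theorem proposition3p17:
  fixes f :: "real^'n \<Rightarrow> real"
    and c :: "real^'n \<Rightarrow> real^'p"
    and A :: "real^'n \<Rightarrow> real^'n"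
    and x :: "real^'n"
    and \<beta> \<theta> :: real
  assumes f_diff: "\<And>y. f differentiable (at y)"
    and c_diff: "\<And>y. c differentiable (at y)"
    and grad_f_lip: "locally_lipschitz norm (grad f)"
    and Jc_lip: "locally_lipschitz opnorm (tjacobian c)"
    and Jc_rank: "\<And>y. y \<in> feasible_set c \<Longrightarrow> rank (tjacobian c y) = CARD('p)"
    and A_diff: "\<And>y. A differentiable (at y)"
    and JA_lip: "locally_lipschitz opnorm (tjacobian A)"
    and A_fix: "\<And>y. y \<in> feasible_set c \<Longrightarrow> A y = y"
    and JA_Jc: "\<And>y. y \<in> feasible_set c \<Longrightarrow> tjacobian A y ** tjacobian c y = 0"
    and x_feasible: "x \<in> feasible_set c"
    and \<beta>_pos: "\<beta> > 0"
    and \<beta>_ge: "\<beta> \<ge> beta_bound f c A x"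
    and \<theta>_range: "0 < \<theta>" "\<theta> \<le> 1 / 2"
    and riem: "riem_lojasiewicz f c x \<theta>"
  shows "lojasiewicz (penalty_fun f c A \<beta>) x \<theta>"
proof -
  define h where "h = penalty_fun f c A \<beta>"
  define G where "G y = tjacobian A y *v grad f (A y)" for y
  define s where "s = sigma_min (tjacobian c x)"
  have s: "s > 0" unfolding s_def using Jc_rank[OF x_feasible] by (rule sigma_min_pos)
  have fix_tangent: "transpose (tjacobian A z) *v v = v"
    if "z \<in> feasible_set c" "transpose (tjacobian c z) *v v = 0" for z v
    using c_diff Jc_lip Jc_rank[OF that(1)] A_diff JA_lip A_fix that by (rule derivative_fixes_tangent)
  have idem: "tjacobian A z ** tjacobian A z = tjacobian A z" if "z \<in> feasible_set c" for z
    using fix_tangent[OF that] JA_Jc[OF that] by (rule tjacobian_idempotent)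
  obtain K d where K: "K \<ge> 0" and d: "d > 0"
    and feas: "\<And>y. y \<in> ball x d \<Longrightarrow> norm (c y) \<le> K * norm (grad h y)"
    using norm_constraint_le_grad_penalty[OF f_diff c_diff grad_f_lip Jc_lip Jc_rank[OF x_feasible]
        A_diff JA_lip idem JA_Jc[OF x_feasible] x_feasible \<beta>_pos \<beta>_ge]
    unfolding h_def by auto
  obtain U C where U: "openin (top_of_set (feasible_set c)) U" "x \<in> U" and C: "C > 0"
    and loj: "\<And>z. z \<in> U \<Longrightarrow> C * \<bar>f z - f x\<bar> powr (1 - \<theta>) \<le> norm (riem_grad f c z)"
    using riem unfolding riem_lojasiewicz_def by blast
  obtain e where e: "e > 0" "ball x e \<inter> feasible_set c \<subseteq> U"
    using U by (meson openin_contains_ball)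
  have "locally_lipschitz norm G"
    unfolding G_def
    by (rule locally_lipschitz_mult_vec[OF JA_lip locally_lipschitz_compose[OF
          locally_lipschitz_of_tjacobian[OF A_diff JA_lip] grad_f_lip]])
  then obtain r L where r: "r > 0" and L: "L \<ge> 0"
    "\<And>y z. y \<in> ball x r \<Longrightarrow> z \<in> ball x r \<Longrightarrow> norm (G y - G z) \<le> L * norm (y - z)"
    by (rule locally_lipschitzE[of norm G x]) blast
  obtain r' L' where r': "r' > 0" "L' \<ge> 0"
    "\<And>y z. y \<in> ball x r' \<Longrightarrow> z \<in> ball x r' \<Longrightarrow> opnorm (tjacobian c y - tjacobian c z) \<le> L' * norm (y - z)"
    using locally_lipschitzE[OF Jc_lip, of x] by metis
  define M where "M = opnorm (tjacobian c x) + L' * r'"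
  have M0: "M \<ge> 0" using r' by (simp add: M_def opnorm_nonneg)
  have M: "opnorm (tjacobian c y) \<le> M" if "y \<in> ball x r'" for y
  proof -
    have "opnorm (tjacobian c y - tjacobian c x) \<le> L' * norm (y - x)" using r' that by simp
    also have "\<dots> \<le> L' * r'"
      using that r' by (intro mult_left_mono) (auto simp: dist_norm norm_minus_commute)
    finally show ?thesis
      using norm_opnorm_diff_le[of "tjacobian c y" "tjacobian c x"] by (simp add: M_def)
  qed
  obtain d' where d': "d' > 0" and near: "\<And>y. y \<in> ball x d' \<Longrightarrow>
      \<exists>z\<in>feasible_set c. z \<in> ball x (min e r) \<and> norm (z - y) \<le> 2 / s * norm (c y)"
    using exists_feasible_near[OF c_diff Jc_lip x_feasible Jc_rank[OF x_feasible], of "min e r"] e r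
    unfolding s_def by auto
  have h_der: "(h has_derivative (\<lambda>v. v \<bullet> (G y + \<beta> *\<^sub>R (tjacobian c y *v c y)))) (at y)" for y
    unfolding h_def G_def by (rule has_derivative_penalty_fun[OF A_diff f_diff c_diff])
  have "isCont h x" using h_der has_derivative_continuous by blast
  then obtain d'' where d'': "d'' > 0" "\<And>y. dist y x < d'' \<Longrightarrow> dist (h y) (h x) < 1"
    unfolding continuous_at_eps_delta by (metis zero_less_one)
  \<comment> \<open>With \<open>N = norm (grad h y)\<close>, the constants bound \<open>norm (z - y)\<close> and \<open>norm (G z)\<close> by \<open>K1 * N\<close>
    and \<open>K2 * N\<close>, the quadratic part of \<open>h y - h x\<close> by \<open>K3 * N\<^sup>2\<close>, and finally
    \<open>\<bar>h y - h x\<bar> powr (1 - \<theta>)\<close> by \<open>K4 * N\<close>.\<close>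
  define K1 where "K1 = 2 / s * K"
  define K2 where "K2 = 1 + \<beta> * M * K + L * K1"
  define K3 where "K3 = (K2 + L * K1) * K1 + \<beta> / 2 * K\<^sup>2"
  define K4 where "K4 = 2 * (K3 powr (1 - \<theta>) + K2 / C) + 1"
  have K0: "K1 \<ge> 0" "K2 \<ge> 0" "K3 \<ge> 0"
    using K s \<beta>_pos M0 L by (auto simp: K1_def K2_def K3_def)
  have K4: "K4 > 0"
    using K0 C by (simp add: K4_def add_nonneg_pos)
  define t where "t = Min {d, r, r', d', d''}"
  have t: "t > 0" using d r r' d' d'' by (simp add: t_def)
  have t_le: "t \<le> d" "t \<le> r" "t \<le> r'" "t \<le> d'" "t \<le> d''"
    unfolding t_def by (rule Min_le; simp)+
  have main: "\<bar>h y - h x\<bar> powr (1 - \<theta>) \<le> K4 * norm (grad h y)" if y: "y \<in> ball x t" for y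
  proof -
    define N where "N = norm (grad h y)"
    have N: "N \<ge> 0" by (simp add: N_def)
    have cy: "norm (c y) \<le> K * N" using feas[of y] y t_le by (simp add: N_def)
    obtain z where z: "z \<in> feasible_set c" "z \<in> ball x e" "z \<in> ball x r"
      and zy: "norm (z - y) \<le> 2 / s * norm (c y)" using near[of y] y t_le by auto
    have "2 / s * norm (c y) \<le> 2 / s * (K * N)" using cy s by (intro mult_left_mono) auto
    with zy have zy: "norm (z - y) \<le> K1 * N" by (simp add: K1_def)
    have zU: "z \<in> U" using z e by auto
    have Gz: "norm (G z) \<le> K2 * N"
    proof -
      have "grad h y = G y + \<beta> *\<^sub>R (tjacobian c y *v c y)" by (rule grad_eqI[OF h_der])
      then have "G z = grad h y - \<beta> *\<^sub>R (tjacobian c y *v c y) + (G z - G y)" by simp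
      then have "norm (G z) \<le> norm (grad h y) + norm (\<beta> *\<^sub>R (tjacobian c y *v c y)) + norm (G z - G y)"
        by (metis norm_triangle_le norm_triangle_ineq4 add_right_mono)
      also have "\<dots> \<le> N + \<beta> * (M * (K * N)) + L * (K1 * N)"
      proof (intro add_mono)
        have "norm (tjacobian c y *v c y) \<le> M * (K * N)"
          using M[of y] y t_le cy M0
          by (intro order_trans[OF norm_mult_le_opnorm] mult_mono) auto
        then show "norm (\<beta> *\<^sub>R (tjacobian c y *v c y)) \<le> \<beta> * (M * (K * N))" using \<beta>_pos by simp
        have "norm (G z - G y) \<le> L * norm (z - y)" using z y t_le by (intro L) auto
        also have "\<dots> \<le> L * (K1 * N)" using zy L by (intro mult_left_mono) auto
        finally show "norm (G z - G y) \<le> L * (K1 * N)" .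
      qed (simp add: N_def)
      finally show ?thesis by (simp add: K2_def algebra_simps)
    qed
    have riem_le: "C * \<bar>f z - f x\<bar> powr (1 - \<theta>) \<le> K2 * N"
      using loj[OF zU] norm_riem_grad_le[OF fix_tangent[OF z(1)] Jc_rank[OF z(1)], of f] Gz A_fix[OF z(1)]
      by (simp add: G_def)
    have g_diff: "\<bar>f (A y) - f z\<bar> \<le> (K2 + L * K1) * K1 * N\<^sup>2"
    proof -
      have sub: "closed_segment z y \<subseteq> ball x r"
        using z y t_le by (intro closed_segment_subset convex_ball) auto
      have "norm (f (A y) - f (A z)) \<le> (K2 * N + L * (K1 * N)) * norm (y - z)"
      proof (rule differentiable_bound[OF convex_closed_segment])
        fix u assume u: "u \<in> closed_segment z y"
        show "((\<lambda>y. f (A y)) has_derivative (\<lambda>v. v \<bullet> G u)) (at u within closed_segment z y)"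
          unfolding G_def
          by (rule has_derivative_at_withinI[OF has_derivative_compose_grad[OF A_diff f_diff]])
        have "norm (G u - G z) \<le> L * norm (u - z)" using u sub z by (intro L) auto
        also have "\<dots> \<le> L * norm (y - z)"
          using segment_bound(1)[OF u] L by (intro mult_left_mono) auto
        also have "\<dots> \<le> L * (K1 * N)"
          using zy L by (intro mult_left_mono) (auto simp: norm_minus_commute)
        finally have "norm (G u) \<le> K2 * N + L * (K1 * N)"
          using Gz norm_triangle_sub[of "G u" "G z"] by simp
        then show "onorm (\<lambda>v. v \<bullet> G u) \<le> K2 * N + L * (K1 * N)"
          by (intro onorm_le) (metis mult.commute mult_right_mono norm_ge_zero order_trans
            Cauchy_Schwarz_ineq2 real_norm_def)
      qed auto
      also have "\<dots> \<le> (K2 * N + L * (K1 * N)) * (K1 * N)"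
        using zy K0 N L by (intro mult_left_mono) (auto simp: norm_minus_commute)
      finally show ?thesis using A_fix[OF z(1)] by (simp add: power2_eq_square algebra_simps)
    qed
    have c2: "\<beta> / 2 * (norm (c y))\<^sup>2 \<le> \<beta> / 2 * K\<^sup>2 * N\<^sup>2"
      using power_mono[OF cy, of 2] \<beta>_pos by (simp add: power_mult_distrib)
    have "h y - h x = (f (A y) - f z) + \<beta> / 2 * (norm (c y))\<^sup>2 + (f z - f x)"
      using x_feasible A_fix[OF x_feasible] by (simp add: h_def penalty_fun_def feasible_set_def)
    then have "\<bar>h y - h x\<bar> \<le> (\<bar>f (A y) - f z\<bar> + \<beta> / 2 * (norm (c y))\<^sup>2) + \<bar>f z - f x\<bar>"
      using \<beta>_pos abs_triangle_ineq[of "f (A y) - f z + \<beta> / 2 * (norm (c y))\<^sup>2" "f z - f x"]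
        abs_triangle_ineq[of "f (A y) - f z" "\<beta> / 2 * (norm (c y))\<^sup>2"] by simp
    moreover have "\<bar>f (A y) - f z\<bar> + \<beta> / 2 * (norm (c y))\<^sup>2 \<le> K3 * N\<^sup>2"
      using g_diff c2 by (simp add: K3_def distrib_right)
    moreover have "\<bar>h y - h x\<bar> \<le> 1" using d''(2)[of y] y t_le by (simp add: dist_commute dist_real_def)
    ultimately show ?thesis
      unfolding N_def[symmetric] K4_def using riem_le \<theta>_range N K0 C \<beta>_pos
      by (intro powr_le_linear_of_split[where a = "\<bar>f (A y) - f z\<bar> + \<beta> / 2 * (norm (c y))\<^sup>2"
            and b = "\<bar>f z - f x\<bar>"]) auto
  qed
  have "1 / K4 * \<bar>h y - h x\<bar> powr (1 - \<theta>) \<le> norm (grad h y)" if "y \<in> ball x t" for y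
    using main[OF that] K4 by (simp add: field_simps)
  then show ?thesis
    unfolding lojasiewicz_def h_def[symmetric] using \<theta>_range t K4
    by (intro conjI exI[of _ "ball x t"] exI[of _ "1 / K4"]) auto
qed

end
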